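(* For fixed $t\in\mathbb{R}$, let $\mathrm{p}(n,t)$ be the coefficient of $x^{n-2}$ in the monic orthogonal polynomial $P_n(x;t)$ of degree $n$ with respect to the weight $w(x;t)=\mathrm{e}^{-x^6+tx^2}$ on $\mathbb{R}$. Then, as $n\to\infty$, \begin{align*} \mathrm{p}(n,t)=&-\frac{3\,n^{4/3}}{4\sqrt[3]{60}}-\frac{n^{2/3}t}{2\sqrt[3]{450}}+\frac{n^{1/3}}{2\sqrt[3]{60}}-\frac{t^2}{90}+\frac{t}{6\sqrt[3]{450}\,n^{1/3}}-\frac{2t^3-45}{810\sqrt[3]{60}\,n^{2/3}}\\ &+\frac{t^4}{2430\sqrt[3]{450}\,n^{4/3}}-\frac{4t^3-135}{4860\sqrt[3]{60}\,n^{5/3}}+O(n^{-2}). \end{align*}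
   Context: For $t\in\mathbb{R}$, let $P_n(x;t)$, $n=0,1,2,\ldots$, be the monic polynomials of degree $n$ orthogonal with respect to $w(x;t)=\mathrm{e}^{-x^6+tx^2}$ on $\mathbb{R}$: $\int_{-\infty}^{\infty}P_j(x;t)P_k(x;t)w(x;t)\,dx=h_j(t)\delta_{jk}$ with $h_j(t)>0$. Since the weight is even, $P_n(-x;t)=(-1)^nP_n(x;t)$, so $P_n(x;t)=x^n+\mathrm{p}(n,t)x^{n-2}+\cdots$, with $\mathrm{p}(0,t)=\mathrm{p}(1,t)=0$. The implied constant in the $O$-term may depend on $t$. *)

theory Defs
  imports
    "HOL-Analysis.Analysis"
    "HOL-Computational_Algebra.Polynomial"
    "HOL-Library.Landau_Symbols"
begin

definition sextic_weight :: "real \<Rightarrow> real \<Rightarrow> real" where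
  "sextic_weight t x = exp (- (x ^ 6) + t * x ^ 2)"

definition monic_orthogonal_polys :: "(real \<Rightarrow> real) \<Rightarrow> (nat \<Rightarrow> real poly) \<Rightarrow> bool" where
  "monic_orthogonal_polys w P \<longleftrightarrow>
     (\<forall>n. degree (P n) = n \<and> lead_coeff (P n) = 1) \<and>
     (\<exists>h :: nat \<Rightarrow> real. (\<forall>j. h j > 0) \<and>
        (\<forall>j k. has_bochner_integral lborel (\<lambda>x. poly (P j) x * poly (P k) x * w x)
                 (if j = k then h j else 0)))"

text \<open>The case distinction avoids truncated subtraction: without it, the indices 0 and 1
  would yield the constant coefficient instead of 0.\<close>

definition subleading_coeff :: "(nat \<Rightarrow> real poly) \<Rightarrow> nat \<Rightarrow> real" where
  "subleading_coeff P n = (if n < 2 then 0 else coeff (P n) (n - 2))"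

end

(* The coefficients beta_n of x P_n = P_(n+1) + beta_n P_(n-1) satisfy the string equation
     6 beta_n (sum of ten quadratic monomials in beta_(n-2), ..., beta_(n+2)) - 2 t beta_n = n,
   obtained by integrating (P_n P_(n-1) w)'. Integrating (P_n P_(n-3) w)' as well, and using
   p(n+1) = p(n) - beta_n, expresses p(n) as a polynomial in neighbouring beta's, so no
   summation of beta's (which would leave the constant term undetermined) is needed.

   Freud's limsup/liminf argument yields beta_n ~ (n/60)^(1/3). The linearization of the string
   equation at this constant profile is strictly diagonally dominant (16 against 1 + 6 + 6 + 1),
   so beta_n is as close to a formal solution as that solution's residual is small.
   With c = (n/60)^(1/3) and a = t/90 the formal solution
     c + a c^(-1) + (1/64800 - a^3/3) c^(-5) + (a^4/3 - a/97200) c^(-7)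
   has residual O(c^(-7)), which determines beta_n up to O(n^(-3)) and p(n) up to O(n^(-2)). *)

theory Submission
  imports Defs "HOL-Real_Asymp.Real_Asymp"
begin

section \<open>The cubic form of the string equation\<close>

text \<open>The comparison takes place after division by c = \<open>cbrt60\<close> at the middle
  index. The string equation then reads \<open>freud6\<close> = 10 + 30 a y^2 z, where z is the
  middle entry and y = 1/c, and both the exact and the formal solution tend to 1. Since p(n) carries
  a factor c^4, a relative accuracy of y^10 leaves y^6, which is the order n^(-2): this decides
  where the formal solution is cut off. The obstacle is that the string equation couples each
  \<beta> to later ones as well as to earlier ones, so errors cannot be propagated by induction from
  starting values. Diagonal dominance bounds the error at one index by the largest error over a
  whole tail, and suprema over tails do obey a forward recursion. Dominance is available only near
  the constant profile, so convergence has to be proved beforehand, by a monotonicity argument that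
  rests on positivity.\<close>

definition freud6 :: "real \<Rightarrow> real \<Rightarrow> real \<Rightarrow> real \<Rightarrow> real \<Rightarrow> real" where
  "freud6 p q z r s = z * (p * q + q ^ 2 + 2 * q * z + q * r + z ^ 2 + 2 * z * r + r ^ 2 + r * s)"

text \<open>The gradient of \<open>freud6\<close> at \<open>(1, 1, 1, 1, 1)\<close> is \<open>(1, 6, 16, 6, 1)\<close>, and \<open>16 > 1 + 6 + 6 + 1\<close>.\<close>

lemma freud6_diagonally_dominant:
  assumes "\<bar>p - 1\<bar> \<le> 1/100" "\<bar>q - 1\<bar> \<le> 1/100" "\<bar>z - 1\<bar> \<le> 1/100" "\<bar>r - 1\<bar> \<le> 1/100" "\<bar>s - 1\<bar> \<le> 1/100"
    and "\<bar>p' - 1\<bar> \<le> 1/100" "\<bar>q' - 1\<bar> \<le> 1/100" "\<bar>z' - 1\<bar> \<le> 1/100" "\<bar>r' - 1\<bar> \<le> 1/100" "\<bar>s' - 1\<bar> \<le> 1/100"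
    and "\<bar>p - p'\<bar> \<le> M" "\<bar>q - q'\<bar> \<le> M" "\<bar>r - r'\<bar> \<le> M" "\<bar>s - s'\<bar> \<le> M"
  shows "78/5 * \<bar>z - z'\<bar> \<le> \<bar>freud6 p q z r s - freud6 p' q' z' r' s'\<bar> + 143/10 * M"
proof -
  define lo hi :: real where "lo = 99/100" and "hi = 101/100"
  have bounds: "lo \<le> v \<and> v \<le> hi" if "\<bar>v - 1\<bar> \<le> 1/100" for v
    using that unfolding lo_def hi_def by linarith
  note b = bounds[OF assms(1)] bounds[OF assms(2)] bounds[OF assms(3)] bounds[OF assms(4)]
    bounds[OF assms(5)] bounds[OF assms(6)] bounds[OF assms(7)] bounds[OF assms(8)]
    bounds[OF assms(9)] bounds[OF assms(10)]
  have pos: "0 \<le> lo" "0 \<le> hi" by (auto simp: lo_def hi_def)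
  have lower: "lo * lo \<le> v * w" if "lo \<le> v" "lo \<le> w" for v w
    using that pos by (intro mult_mono) auto
  have upper: "v * w \<le> hi * C" if "lo \<le> v" "v \<le> hi" "0 \<le> w" "w \<le> C" for v w C
    using that pos by (intro mult_mono) auto
  \<comment> \<open>Discrete partial derivatives: the difference is (z - z') times the bracket plus
    z' times the difference of the brackets, with v w - v' w' split symmetrically as (v - v')(w +
    w')/2 + (w - w')(v + v')/2. At the all-ones point they equal 1, 6, 16, 6, 1. The constants of
    the claim come from 16 * 0.99^2 > 78/5 and 14 * 1.01^2 < 143/10.\<close>
  define gp where "gp = z' * (q + q') / 2"
  define gq where "gq = z' * ((p + p') / 2 + (q + q') + (z + z') + (r + r') / 2)"
  define gz where "gz = p * q + q ^ 2 + 2 * q * z + q * r + z ^ 2 + 2 * z * r + r ^ 2 + r * s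
          + z' * ((q + q') + (z + z') + (r + r'))"
  define gr where "gr = z' * ((q + q') / 2 + (z + z') + (r + r') + (s + s') / 2)"
  define gs where "gs = z' * (r + r') / 2"
  have g: "0 \<le> gp" "0 \<le> gq" "0 \<le> gr" "0 \<le> gs"
    unfolding gp_def gq_def gr_def gs_def using b pos by auto
  have "gz \<ge> 16 * (lo * lo)"
  proof -
    have "z' * ((q + q') + (z + z') + (r + r')) \<ge> lo * (6 * lo)"
      using b pos by (intro mult_mono) auto
    moreover note lower[of p q] lower[of q q] lower[of q z] lower[of q r] lower[of z z]
      lower[of z r] lower[of r r] lower[of r s]
    ultimately show ?thesis
      unfolding gz_def power2_eq_square using b by linarith
  qed
  then have gz: "gz \<ge> 78/5" by (simp add: lo_def)
  have gp': "gp \<le> hi * hi"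
    using upper[of z' "(q + q') / 2" hi] b pos by (simp add: gp_def)
  have gs': "gs \<le> hi * hi"
    using upper[of z' "(r + r') / 2" hi] b pos by (simp add: gs_def)
  have sum_le: "v / 2 + w + x + y / 2 \<le> 6 * hi" if "v \<le> 2 * hi" "w \<le> 2 * hi" "x \<le> 2 * hi" "y \<le> 2 * hi" for v w x y
    using that by linarith
  have gq': "gq \<le> hi * (6 * hi)"
    unfolding gq_def using b pos by (intro mult_mono sum_le) auto
  have gr': "gr \<le> hi * (6 * hi)"
    unfolding gr_def using b pos sum_le[of "q + q'" "z + z'" "r + r'" "s + s'"] by (intro mult_mono) auto
  have "M \<ge> 0" using assms(11) by linarith
  have term_le: "\<bar>d * g\<bar> \<le> g * M" if "\<bar>d\<bar> \<le> M" "0 \<le> g" for d g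
    using that mult_right_mono[of "\<bar>d\<bar>" M g] by (simp add: abs_mult mult_ac)
  have "freud6 p q z r s - freud6 p' q' z' r' s' = (z - z') * gz + (p - p') * gp
      + (q - q') * gq + (r - r') * gr + (s - s') * gs"
    unfolding freud6_def gp_def gq_def gz_def gr_def gs_def by (simp add: field_simps power2_eq_square)
  then have "\<bar>(z - z') * gz\<bar> \<le> \<bar>freud6 p q z r s - freud6 p' q' z' r' s'\<bar>
      + (gp * M + gq * M + gr * M + gs * M)"
    using term_le[OF assms(11) g(1)] term_le[OF assms(12) g(2)]
      term_le[OF assms(13) g(3)] term_le[OF assms(14) g(4)] by linarith
  also have "gp * M + gq * M + gr * M + gs * M = (gp + gq + gr + gs) * M"
    by (simp add: algebra_simps)
  also have "\<dots> \<le> 143/10 * M"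
    using gp' gq' gr' gs' \<open>M \<ge> 0\<close> by (intro mult_right_mono) (auto simp: hi_def)
  finally have "\<bar>(z - z') * gz\<bar> \<le> \<bar>freud6 p q z r s - freud6 p' q' z' r' s'\<bar> + 143/10 * M"
    by simp
  moreover have "78/5 * \<bar>z - z'\<bar> \<le> \<bar>(z - z') * gz\<bar>"
    using gz mult_right_mono[OF gz, of "\<bar>z - z'\<bar>"] by (simp add: abs_mult mult_ac)
  ultimately show ?thesis by linarith
qed

lemma freud6_scale: "freud6 (k * p) (k * q) (k * z) (k * r) (k * s) = k ^ 3 * freud6 p q z r s"
  by (simp add: freud6_def algebra_simps power2_eq_square power3_eq_cube)

lemma freud6_mono:
  assumes "0 \<le> p" "0 \<le> q" "0 \<le> z" "0 \<le> r" "0 \<le> s"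
    and "p \<le> p'" "q \<le> q'" "z \<le> z'" "r \<le> r'" "s \<le> s'"
  shows "freud6 p q z r s \<le> freud6 p' q' z' r' s'"
proof -
  have "p * q \<le> p' * q'" "q * q \<le> q' * q'" "q * z \<le> q' * z'" "q * r \<le> q' * r'" "z * z \<le> z' * z'"
    "z * r \<le> z' * r'" "r * r \<le> r' * r'" "r * s \<le> r' * s'"
    by (rule mult_mono; use assms in linarith)+
  then have le: "p * q + q ^ 2 + 2 * q * z + q * r + z ^ 2 + 2 * z * r + r ^ 2 + r * s
      \<le> p' * q' + q' ^ 2 + 2 * q' * z' + q' * r' + z' ^ 2 + 2 * z' * r' + r' ^ 2 + r' * s'"
    unfolding power2_eq_square by linarith
  have nonneg: "0 \<le> p * q + q ^ 2 + 2 * q * z + q * r + z ^ 2 + 2 * z * r + r ^ 2 + r * s"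
    using assms(1-5) by simp
  show ?thesis
    unfolding freud6_def by (rule mult_mono[OF assms(8) le _ nonneg]) (use assms(3,8) in linarith)
qed

text \<open>All monomials are nonnegative and one of them is z^3. This yields the a priori bound in
  Freud's argument.\<close>

lemma freud6_ge_cube:
  assumes "0 \<le> p" "0 \<le> q" "0 \<le> z" "0 \<le> r" "0 \<le> s"
  shows "z ^ 3 \<le> freud6 p q z r s"
  using freud6_mono[of 0 0 z 0 0 p q z r s] assms by (simp add: freud6_def power2_eq_square power3_eq_cube)

section \<open>Recurrence coefficients and the string equation\<close>

locale sextic_orthogonal_polys =
  fixes t :: real and P :: "nat \<Rightarrow> real poly" and h :: "nat \<Rightarrow> real"
  assumes degree_P [simp]: "degree (P n) = n"
    and lead_coeff_P: "lead_coeff (P n) = 1"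
    and h_pos: "h n > 0"
    and orthogonal: "has_bochner_integral lborel
      (\<lambda>x. poly (P j) x * poly (P k) x * sextic_weight t x) (if j = k then h j else 0)"
begin

section \<open>The moment functional and expansion in orthogonal polynomials\<close>

definition L :: "real poly \<Rightarrow> real" where
  "L p = (\<integral>x. poly p x * sextic_weight t x \<partial>lborel)"

text \<open>Truncated subtraction makes \<open>\<beta> 0\<close> equal to 1 instead of the customary
  0. The recurrence starts at index 1, and the value 1 keeps positivity valid at every index, as
  \<open>freud6_solution\<close> requires.\<close>

definition \<beta> :: "nat \<Rightarrow> real" where
  "\<beta> n = h n / h (n - 1)"

lemma coeff_P_self [simp]: "coeff (P n) n = 1"
  using lead_coeff_P[of n] by simp

lemma P_0: "P 0 = 1"
  using degree_P[of 0] coeff_P_self[of 0] by (metis degree_0_id one_pCons of_nat_1 of_nat_poly)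

lemma \<beta>_pos: "\<beta> n > 0"
  by (simp add: \<beta>_def h_pos)

lemma h_Suc: "h (Suc n) = \<beta> (Suc n) * h n"
  using h_pos[of n] by (simp add: \<beta>_def)

text \<open>Subtracting a multiple of \<open>P n\<close> lowers the degree bound. The bound is
  expressed by vanishing coefficients so that the zero polynomial and \<open>n = 0\<close> fit
  in.\<close>

lemma basis_induct:
  assumes "\<And>i. i \<ge> n \<Longrightarrow> coeff p i = 0"
    and "Q 0" and "\<And>p q. Q p \<Longrightarrow> Q q \<Longrightarrow> Q (p + q)"
    and "\<And>a k. k < n \<Longrightarrow> Q (smult a (P k))"
  shows "Q p"
  using assms
proof (induction n arbitrary: p)
  case 0
  then have "p = 0" by (intro poly_eqI) simp
  with 0 show ?case by simp
next
  case (Suc n)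
  let ?r = "p - smult (coeff p n) (P n)"
  have "Q ?r"
  proof (rule Suc.IH)
    fix i assume "i \<ge> n"
    then show "coeff ?r i = 0"
      using Suc.prems(1)[of i] by (cases "i = n") (auto simp: coeff_eq_0)
  qed (use Suc.prems in auto)
  then have "Q (?r + smult (coeff p n) (P n))"
    using Suc.prems by blast
  then show ?case by simp
qed

text \<open>Orthogonality against \<open>P 0 = 1\<close> already contains the integrability of each
  \<open>P k\<close> times the weight, and linearity extends it to all polynomials.\<close>

lemma integrable_poly: "integrable lborel (\<lambda>x. poly p x * sextic_weight t x)"
proof (rule basis_induct[of "Suc (degree p)" p])
  fix a k
  have "integrable lborel (\<lambda>x. poly (P k) x * poly (P 0) x * sextic_weight t x)"
    using orthogonal by (rule integrable.intros)
  then have "integrable lborel (\<lambda>x. a * (poly (P k) x * sextic_weight t x))"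
    by (intro integrable_mult_right) (simp add: P_0)
  then show "integrable lborel (\<lambda>x. poly (smult a (P k)) x * sextic_weight t x)"
    by (simp add: mult.assoc)
qed (auto simp: coeff_eq_0 ring_distribs)

lemma L_add: "L (p + q) = L p + L q"
  by (simp add: L_def ring_distribs Bochner_Integration.integral_add integrable_poly)

lemma L_smult: "L (smult a p) = a * L p"
  by (simp add: L_def mult.assoc)

lemma L_0 [simp]: "L 0 = 0"
  by (simp add: L_def)

lemma L_minus: "L (- p) = - L p"
  using L_smult[of "-1" p] by simp

lemma L_diff: "L (p - q) = L p - L q"
  using L_add[of p "- q"] by (simp add: L_minus)

lemma L_orthogonal: "L (P i * P j) = (if i = j then h i else 0)"
  using orthogonal[of i j] unfolding L_def poly_mult by (rule has_bochner_integral_integral_eq)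

lemma L_orthogonal_lower:
  assumes "\<And>i. i \<ge> n \<Longrightarrow> coeff p i = 0" and "\<And>k. k < n \<Longrightarrow> L (q * P k) = 0"
  shows "L (q * p) = 0"
  using assms(1)
proof (rule basis_induct[of n p])
  fix a k assume "k < n"
  then show "L (q * smult a (P k)) = 0"
    using assms(2) by (simp add: L_smult)
qed (auto simp: ring_distribs L_add)

text \<open>Modulo a multiple of \<open>P n\<close>, the polynomial \<open>p\<close> has degree
  below \<open>n\<close> and is orthogonal to \<open>P n\<close>, so only the top coefficient is
  seen.\<close>

lemma L_P_mult:
  assumes "\<And>i. i > n \<Longrightarrow> coeff p i = 0"
  shows "L (P n * p) = coeff p n * h n"
proof -
  let ?r = "p - smult (coeff p n) (P n)"
  have "L (P n * ?r) = 0"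
  proof (rule L_orthogonal_lower[where n = n])
    fix i assume "n \<le> i"
    then show "coeff ?r i = 0"
      using assms[of i] by (cases "i = n") (auto simp: coeff_eq_0)
  qed (auto simp: L_orthogonal)
  then show ?thesis
    by (simp add: ring_distribs right_diff_distrib L_diff L_smult L_orthogonal)
qed

text \<open>A nonzero \<open>r\<close> paired with \<open>P (degree r)\<close> would give its
  leading coefficient times a positive norm.\<close>

lemma eq_0_if_orthogonal:
  assumes "\<And>i. i \<ge> n \<Longrightarrow> coeff r i = 0" and "\<And>k. k < n \<Longrightarrow> L (r * P k) = 0"
  shows "r = 0"
proof (rule ccontr)
  assume "r \<noteq> 0"
  let ?d = "degree r"
  have "?d < n"
    using assms(1)[of ?d] \<open>r \<noteq> 0\<close> by (meson leading_coeff_0_iff not_le)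
  then have "L (P ?d * r) = 0"
    using assms(2)[of ?d] by (simp add: mult.commute)
  moreover have "L (P ?d * r) = lead_coeff r * h ?d"
    by (rule L_P_mult) (simp add: coeff_eq_0)
  ultimately show False
    using \<open>r \<noteq> 0\<close> h_pos[of ?d] by simp
qed

section \<open>Parity and the three-term recurrence\<close>

lemma L_reflect: "L (pcompose p [:0, -1:]) = L p"
  using lborel_integral_real_affine[of "-1" "\<lambda>x. poly p x * sextic_weight t x" 0]
  by (simp add: L_def poly_pcompose sextic_weight_def)

text \<open>The sign-corrected reflection of \<open>P n\<close> is again monic of degree
  \<open>n\<close> and, the weight being even, orthogonal to all lower \<open>P k\<close>; its
  difference from \<open>P n\<close> therefore vanishes.\<close>

lemma P_reflect: "pcompose (P n) [:0, -1:] = smult ((-1) ^ n) (P n)"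
proof -
  let ?R = "\<lambda>p. pcompose p [:0, -1:] :: real poly"
  have reflect2: "?R (?R p) = p" for p
    by (simp flip: pcompose_assoc add: pcompose_pCons)
  let ?r = "smult ((-1) ^ n) (?R (P n)) - P n"
  have "?r = 0"
  proof (rule eq_0_if_orthogonal[of n])
    fix i assume "n \<le> i"
    then show "coeff ?r i = 0"
      by (cases "i = n") (auto simp: coeff_pcompose_linear coeff_eq_0 simp flip: power_mult_distrib)
  next
    fix k assume k: "k < n"
    have "L (?R (P n) * P k) = L (?R (?R (P n) * P k))"
      by (simp only: L_reflect)
    also have "\<dots> = L (P n * ?R (P k))"
      by (simp add: pcompose_mult reflect2)
    also have "\<dots> = 0"
      using k by (subst L_P_mult) (auto simp: coeff_pcompose_linear coeff_eq_0)
    finally show "L (?r * P k) = 0"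
      using k by (simp add: ring_distribs left_diff_distrib L_diff L_smult L_orthogonal)
  qed
  then have "smult ((-1) ^ n) (smult ((-1) ^ n) (?R (P n))) = smult ((-1) ^ n) (P n)"
    by simp
  then show ?thesis
    by (simp flip: power_mult_distrib)
qed

lemma coeff_P_odd: "coeff (P (Suc n)) n = 0"
proof -
  have "coeff (pcompose (P (Suc n)) [:0, -1:]) n = coeff (smult ((-1) ^ Suc n) (P (Suc n))) n"
    by (simp only: P_reflect)
  then show ?thesis
    by (simp add: coeff_pcompose_linear)
qed

text \<open>The defect has degree at most \<open>Suc n\<close> and is orthogonal to
  \<open>P 0\<close>, ..., \<open>P (Suc n)\<close>: the pairing with \<open>P n\<close> cancels by
  the definition of \<beta>, the pairing with \<open>P (Suc n)\<close> by parity.\<close>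

lemma recurrence: "[:0, 1:] * P (Suc n) = P (Suc (Suc n)) + smult (\<beta> (Suc n)) (P n)"
proof -
  let ?X = "[:0, 1:] :: real poly"
  let ?r = "?X * P (Suc n) - P (Suc (Suc n)) - smult (\<beta> (Suc n)) (P n)"
  have "?r = 0"
  proof (rule eq_0_if_orthogonal[of "Suc (Suc n)"])
    fix i assume "Suc (Suc n) \<le> i"
    then show "coeff ?r i = 0"
      by (cases "i = Suc (Suc n)") (auto simp: coeff_eq_0 coeff_pCons split: nat.splits)
  next
    fix k assume k: "k < Suc (Suc n)"
    have *: "L (?X * P (Suc n) * P k) = (if k = n then h (Suc n) else 0)"
    proof (cases "k = Suc n")
      case True
      \<comment> \<open>Here x P_(n+1)^2 is odd, which is why the recurrence has no diagonal
        term.\<close>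
      have "pcompose (?X * P (Suc n) * P k) [:0, -1:] = - (?X * P (Suc n) * P k)"
        using True
        by (simp add: pcompose_mult P_reflect pcompose_pCons flip: power_mult_distrib)
      then have "L (?X * P (Suc n) * P k) = - L (?X * P (Suc n) * P k)"
        using L_reflect[of "?X * P (Suc n) * P k"] by (metis L_minus)
      then have "L (?X * P (Suc n) * P k) = 0" by linarith
      with True show ?thesis by (simp only: if_False n_not_Suc_n[symmetric])
    next
      case False
      with k have "k \<le> n" by simp
      have "?X * P (Suc n) * P k = P (Suc n) * pCons 0 (P k)"
        by (simp add: algebra_simps)
      also have "L \<dots> = coeff (pCons 0 (P k)) (Suc n) * h (Suc n)"
        using \<open>k \<le> n\<close> by (intro L_P_mult) (auto simp: coeff_pCons coeff_eq_0 split: nat.splits)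
      also have "\<dots> = (if k = n then h (Suc n) else 0)"
        using \<open>k \<le> n\<close> by (auto simp: coeff_pCons coeff_eq_0)
      finally show ?thesis .
    qed
    have "L (?r * P k) = L (?X * P (Suc n) * P k) - L (P (Suc (Suc n)) * P k)
        - \<beta> (Suc n) * L (P n * P k)"
      by (simp only: left_diff_distrib L_diff mult_smult_left L_smult)
    also have "\<dots> = 0"
      using k by (simp only: * L_orthogonal) (auto simp: h_Suc)
    finally show "L (?r * P k) = 0" .
  qed
  then show ?thesis by (simp add: algebra_simps)
qed

section \<open>Integration by parts, the string equation and the subleading coefficient\<close>

lemma tendsto_poly_weight:
  assumes "F = at_top \<or> F = at_bot"
  shows "((\<lambda>x. poly p x * sextic_weight t x) \<longlongrightarrow> 0) F"
proof -
  have "((\<lambda>x. x ^ k * exp (- (x ^ 6) + t * x ^ 2)) \<longlongrightarrow> 0) at_top" for k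
    by real_asymp
  moreover have "((\<lambda>x. x ^ k * exp (- (x ^ 6) + t * x ^ 2)) \<longlongrightarrow> 0) at_bot" for k
    by real_asymp
  ultimately have *: "((\<lambda>x. x ^ k * sextic_weight t x) \<longlongrightarrow> 0) F" for k
    using assms by (auto simp: sextic_weight_def)
  have "((\<lambda>x. \<Sum>i\<le>degree p. coeff p i * (x ^ i * sextic_weight t x)) \<longlongrightarrow> (\<Sum>i\<le>degree p. coeff p i * 0)) F"
    by (intro tendsto_intros *)
  then show ?thesis
    by (simp add: poly_altdef sum_distrib_right mult.assoc)
qed

text \<open>Integration by parts with vanishing boundary terms; the fixed factor is - w'/w = 6 x^5 -
  2 t x.\<close>

lemma L_pderiv: "L (pderiv p) = L (p * [:0, -2 * t, 0, 0, 0, 6:])"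
proof -
  let ?v = "[:0, -2 * t, 0, 0, 0, 6:]"
  let ?w = "sextic_weight t"
  let ?F = "\<lambda>x. poly p x * ?w x"
  let ?f = "\<lambda>x. poly (pderiv p - p * ?v) x * ?w x"
  have "(?F has_real_derivative ?f x) (at x)" for x
    unfolding sextic_weight_def
    by (auto intro!: derivative_eq_intros simp: algebra_simps power2_eq_square eval_nat_numeral)
  then have der: "(?F has_vector_derivative ?f x) (at x)" for x
    by (simp add: has_real_derivative_iff_has_vector_derivative)
  have "(LBINT x=-\<infinity>..\<infinity>. ?f x) = 0 - 0"
  proof (rule interval_integral_FTC_integrable[where F = ?F])
    show "isCont ?f x" for x
      unfolding sextic_weight_def by (intro continuous_intros)
    show "set_integrable lborel (einterval (-\<infinity>) \<infinity>) ?f"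
      using integrable_poly[of "pderiv p - p * ?v"] by (simp add: set_integrable_def)
    show "((?F \<circ> real_of_ereal) \<longlongrightarrow> 0) (at_right (-\<infinity>))"
      by (simp add: at_right_MInf o_def filterlim_filtermap tendsto_poly_weight)
    show "((?F \<circ> real_of_ereal) \<longlongrightarrow> 0) (at_left \<infinity>)"
      by (simp add: at_left_PInf o_def filterlim_filtermap tendsto_poly_weight)
  qed (use der in auto)
  then have "L (pderiv p - p * ?v) = 0"
    by (simp add: L_def interval_integral_to_infinity_eq interval_lebesgue_integral_def set_lebesgue_integral_def)
  then show ?thesis by (simp add: L_diff)
qed

text \<open>\<open>T k i j\<close> is a matrix element of \<open>x^k\<close>; the recurrence makes it a sum over lattice paths.\<close>

definition T :: "nat \<Rightarrow> nat \<Rightarrow> nat \<Rightarrow> real" where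
  "T k i j = L ([:0, 1:] ^ k * P i * P j)"

lemma T_0 [simp]: "T 0 i j = (if i = j then h i else 0)"
  by (simp add: T_def L_orthogonal)

lemma T_Suc [simp]: "T (Suc k) (Suc i) j = T k (Suc (Suc i)) j + \<beta> (Suc i) * T k i j"
proof -
  have "[:0, 1:] ^ Suc k * P (Suc i) * P j = [:0, 1:] ^ k * ([:0, 1:] * P (Suc i)) * P j"
    by (simp add: mult_ac)
  also have "\<dots> = [:0, 1:] ^ k * P (Suc (Suc i)) * P j
      + smult (\<beta> (Suc i)) ([:0, 1:] ^ k * P i * P j)"
    by (simp only: recurrence) (simp add: algebra_simps)
  finally show ?thesis by (simp add: T_def L_add L_smult)
qed

lemma L_pderiv_P_mult: "L (pderiv (P i * P j)) = 6 * T 5 i j - 2 * t * T 1 i j"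
proof -
  have *: "[:0, -2 * t, 0, 0, 0, 6:] = smult 6 ([:0, 1:] ^ 5) - smult (2 * t) ([:0, 1:] ^ 1)"
    by (simp add: eval_nat_numeral)
  have "P i * P j * [:0, -2 * t, 0, 0, 0, 6:]
      = smult 6 (P i * P j * [:0, 1:] ^ 5) - smult (2 * t) (P i * P j * [:0, 1:] ^ 1)"
    unfolding * by (simp only: right_diff_distrib mult_smult_right)
  then show ?thesis by (simp only: L_pderiv T_def L_diff L_smult mult_ac)
qed

text \<open>Only P_(n-1) P_n' contributes to the integrated derivative, with value n h_(n-1). On the
  other side stand the five-step paths from n to n-1, each down step weighted by the \<beta> of its
  upper end. There are ten of them, with three down steps each, and all must step down from n to n-1
  at some point: hence the common factor \<open>\<beta> n\<close>.\<close>

lemma string_equation: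
  assumes "n \<ge> 5"
  shows "6 * \<beta> n * (\<beta> (n - 2) * \<beta> (n - 1) + \<beta> (n - 1) ^ 2 + 2 * \<beta> (n - 1) * \<beta> n
      + \<beta> (n - 1) * \<beta> (n + 1) + \<beta> n ^ 2 + 2 * \<beta> n * \<beta> (n + 1) + \<beta> (n + 1) ^ 2
      + \<beta> (n + 1) * \<beta> (n + 2)) - 2 * t * \<beta> n = real n"
proof -
  \<comment> \<open>Writing n as a fivefold successor keeps the first index of \<open>T\<close>
    positive through all five applications of \<open>T_Suc\<close>.\<close>
  obtain m where n: "n = Suc (Suc (Suc (Suc (Suc m))))"
    by (rule that[of "n - 5"]) (use assms in linarith)
  let ?k = "Suc (Suc (Suc (Suc m)))"
  have "L (pderiv (P n * P ?k)) = L (P n * pderiv (P ?k)) + L (P ?k * pderiv (P n))"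
    by (simp add: pderiv_mult L_add)
  also have "L (P n * pderiv (P ?k)) = 0"
    by (subst L_P_mult) (auto simp: n coeff_pderiv coeff_eq_0)
  also have "L (P ?k * pderiv (P n)) = real n * h ?k"
    using coeff_P_self[of n] by (subst L_P_mult) (auto simp: n coeff_pderiv coeff_eq_0)
  finally have "6 * T 5 n ?k - 2 * t * T 1 n ?k = real n * h ?k"
    by (simp add: L_pderiv_P_mult)
  then have "h ?k * (6 * \<beta> n * (\<beta> (n - 2) * \<beta> (n - 1) + \<beta> (n - 1) ^ 2 + 2 * \<beta> (n - 1) * \<beta> n
      + \<beta> (n - 1) * \<beta> (n + 1) + \<beta> n ^ 2 + 2 * \<beta> n * \<beta> (n + 1) + \<beta> (n + 1) ^ 2
      + \<beta> (n + 1) * \<beta> (n + 2)) - 2 * t * \<beta> n) = h ?k * real n"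
    by (simp add: n eval_nat_numeral h_Suc algebra_simps)
  then show ?thesis
    using h_pos[of ?k] by simp
qed

text \<open>Index 0 is excluded because both coefficients are 0 there while \<open>\<beta> 0\<close>
  is 1.\<close>

lemma subleading_coeff_Suc: "n > 0 \<Longrightarrow> subleading_coeff P (Suc n) = subleading_coeff P n - \<beta> n"
proof (induction n)
  case (Suc n)
  have "coeff ([:0, 1:] * P (Suc n)) n = coeff (P (Suc (Suc n)) + smult (\<beta> (Suc n)) (P n)) n"
    by (simp only: recurrence)
  then show ?case
    by (cases n) (auto simp: subleading_coeff_def coeff_pCons)
qed simp

text \<open>The left-hand side is the coefficient of P_(n-3) when P_n' is expanded in the orthogonal
  basis. The right-hand side counts the five paths from n to n-3 in five steps: the three forced
  descents give the common factor, and the one excursion gives the sum. A single step cannot bridge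
  the distance 3, so \<open>t\<close> is absent.\<close>

lemma subleading_coeff_relation:
  assumes "n \<ge> 5"
  shows "(real n - 2) * subleading_coeff P n - real n * subleading_coeff P (n - 1)
    = 6 * \<beta> n * \<beta> (n - 1) * \<beta> (n - 2)
      * (\<beta> (n - 3) + \<beta> (n - 2) + \<beta> (n - 1) + \<beta> n + \<beta> (n + 1))"
proof -
  obtain m where n: "n = Suc (Suc (Suc (Suc (Suc m))))"
    by (rule that[of "n - 5"]) (use assms in linarith)
  let ?k = "Suc (Suc m)"
  let ?q = "pderiv (P n) - smult (real n) (P (Suc (Suc ?k)))"
  have "L (P ?k * ?q) = coeff ?q ?k * h ?k"
  proof (rule L_P_mult)
    fix i assume "i > ?k"
    then consider "i = Suc ?k" | "i = Suc (Suc ?k)" | "i > Suc (Suc ?k)" by linarith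
    then show "coeff ?q i = 0"
    proof cases
      case 1
      then show ?thesis
        using coeff_P_odd[of "Suc ?k"] coeff_P_odd[of "Suc (Suc ?k)"] by (simp add: n coeff_pderiv)
    next
      case 2
      then show ?thesis
        using coeff_P_self[of n] by (simp add: n coeff_pderiv)
    qed (auto simp: n coeff_pderiv coeff_eq_0)
  qed
  also have "coeff ?q ?k = (real n - 2) * subleading_coeff P n - real n * subleading_coeff P (n - 1)"
    by (simp add: n coeff_pderiv subleading_coeff_def)
  finally have "L (P ?k * ?q)
    = ((real n - 2) * subleading_coeff P n - real n * subleading_coeff P (n - 1)) * h ?k" .
  moreover have "L (pderiv (P n * P ?k)) = L (P n * pderiv (P ?k)) + L (P ?k * pderiv (P n))"
    by (simp add: pderiv_mult L_add)
  moreover have "L (P n * pderiv (P ?k)) = 0"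
    by (subst L_P_mult) (auto simp: n coeff_pderiv coeff_eq_0)
  moreover have "L (P ?k * ?q) = L (P ?k * pderiv (P n))"
    by (simp add: right_diff_distrib L_diff L_smult L_orthogonal)
  ultimately have "((real n - 2) * subleading_coeff P n - real n * subleading_coeff P (n - 1)) * h ?k
    = 6 * T 5 n ?k - 2 * t * T 1 n ?k"
    by (simp add: L_pderiv_P_mult)
  also have "\<dots> = (6 * \<beta> n * \<beta> (n - 1) * \<beta> (n - 2)
      * (\<beta> (n - 3) + \<beta> (n - 2) + \<beta> (n - 1) + \<beta> n + \<beta> (n + 1))) * h ?k"
    by (simp add: n eval_nat_numeral h_Suc algebra_simps)
  finally show ?thesis
    using h_pos[of ?k] by simp
qed

text \<open>At index n+1 the relation involves p(n+1) and p(n). Eliminating p(n+1) leaves p(n) with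
  the coefficient (n-1) - (n+1) = -2, so it can be solved for.\<close>

lemma subleading_coeff_eq:
  assumes "n \<ge> 4"
  shows "subleading_coeff P n = - ((real n - 1) * \<beta> n + 6 * \<beta> (n + 1) * \<beta> n * \<beta> (n - 1)
      * (\<beta> (n - 2) + \<beta> (n - 1) + \<beta> n + \<beta> (n + 1) + \<beta> (n + 2))) / 2"
proof -
  have "(real n - 1) * (subleading_coeff P n - \<beta> n) - (real n + 1) * subleading_coeff P n
      = 6 * \<beta> (n + 1) * \<beta> n * \<beta> (n - 1)
      * (\<beta> (n - 2) + \<beta> (n - 1) + \<beta> n + \<beta> (n + 1) + \<beta> (n + 2))"
    using subleading_coeff_relation[of "Suc n"] subleading_coeff_Suc[of n] assms
    by (simp add: algebra_simps numeral_3_eq_3 numeral_2_eq_2)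
  then show ?thesis by (simp add: algebra_simps)
qed

end

section \<open>The formal solution\<close>

text \<open>The number 60 is 6 * 10: a constant profile turns the leading part of the string
  equation into 60 \<beta>^3 = n.\<close>

definition cbrt60 :: "real \<Rightarrow> real" where
  "cbrt60 x = (x / 60) powr (1/3)"

lemma cbrt60_pos: "x > 0 \<Longrightarrow> cbrt60 x > 0"
  by (simp add: cbrt60_def)

lemma cbrt60_cube: "x > 0 \<Longrightarrow> cbrt60 x ^ 3 = x / 60"
  by (simp add: cbrt60_def powr_power)

lemma cbrt60_shift:
  assumes "x > 0" "x + j > 0"
  shows "cbrt60 (x + j) = cbrt60 x * (1 + j / x) powr (1/3)"
proof -
  have "(x + j) / 60 = (x / 60) * (1 + j / x)"
    using assms by (simp add: field_simps)
  moreover have "1 + j / x = (x + j) / x" using assms by (simp add: field_simps)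
  ultimately show ?thesis
    using assms unfolding cbrt60_def by (subst powr_mult[symmetric]) auto
qed

lemma cbrt60_ratio_tendsto: "((\<lambda>n. cbrt60 (real (n + j)) / cbrt60 (real (n + k))) \<longlongrightarrow> 1) sequentially"
  unfolding cbrt60_def by real_asymp

lemma cbrt60_at_top: "filterlim (\<lambda>n. cbrt60 (real (n + k))) at_top sequentially"
  unfolding cbrt60_def by real_asymp

text \<open>All five entries are divided by the scale of the middle index, not each by its own, so
  that homogeneity of degree 3 applies.\<close>

lemma freud6_normalized:
  fixes b :: "nat \<Rightarrow> real"
  defines "X j n \<equiv> b (n + j) / cbrt60 (real (n + 2))"
  assumes eq: "freud6 (b n) (b (n + 1)) (b (n + 2)) (b (n + 3)) (b (n + 4))
        = real (n + 2) / 6 + t / 3 * b (n + 2)"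
  shows "freud6 (X 0 n) (X 1 n) (X 2 n) (X 3 n) (X 4 n)
    = 10 + t / 3 * X 2 n / cbrt60 (real (n + 2)) ^ 2"
proof -
  let ?c = "cbrt60 (real (n + 2))"
  have c: "?c > 0" "real (n + 2) / 6 = 10 * ?c ^ 3"
    using cbrt60_pos[of "real (n + 2)"] cbrt60_cube[of "real (n + 2)"] by simp_all
  have bX: "b (n + j) = ?c * X j n" for j
    using c by (simp add: X_def)
  have "?c ^ 3 * freud6 (X 0 n) (X 1 n) (X 2 n) (X 3 n) (X 4 n) = 10 * ?c ^ 3 + t / 3 * (?c * X 2 n)"
    unfolding c(2)[symmetric] using eq freud6_scale[of ?c "X 0 n" "X 1 n" "X 2 n" "X 3 n" "X 4 n"] bX[of 0] bX[of 1] bX[of 2] bX[of 3] bX[of 4]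
    by simp
  also have "\<dots> = ?c ^ 3 * (10 + t / 3 * X 2 n / ?c ^ 2)"
    using c(1) by (simp add: field_simps power2_eq_square power3_eq_cube)
  finally show ?thesis using c(1) by simp
qed

section \<open>Polynomial identities for the formal solution\<close>

lemma bigo_at_right_power:
  fixes g :: "real \<Rightarrow> real"
  assumes "isCont g 0"
  shows "(\<lambda>y. y ^ k * g y) \<in> O[at_right 0](\<lambda>y. y ^ k)"
proof -
  have "(g \<longlongrightarrow> g 0) (at_right 0)"
    using assms by (simp add: continuous_within_open filterlim_at_split isCont_def)
  then have "g \<in> O[at_right 0](\<lambda>_. 1)"
    by (intro bigoI_tendsto[where c = "g 0"]) auto
  from landau_o.big.mult_left[OF this, of "\<lambda>y. y ^ k"] show ?thesis by simp
qed

text \<open>With \<open>c = cbrt60 x\<close> and \<open>y = 1 / c\<close>, the formal solution satisfies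
  \<open>b_approx a (x + j) / c = A\<^sub>0 + j A\<^sub>1 + j\<^sup>2 A\<^sub>2 + j\<^sup>3 A\<^sub>3 + O(y^10)\<close>. The vanishing of the coefficients of
  \<open>y^6\<close> and \<open>y^8\<close> in the residual of the string equation fixes those of \<open>A\<^sub>0\<close>.\<close>

definition A\<^sub>0 :: "real \<Rightarrow> real \<Rightarrow> real" where
  "A\<^sub>0 a y = 1 + a * y ^ 2 + (1 / 64800 - a ^ 3 / 3) * y ^ 6 + (a ^ 4 / 3 - a / 97200) * y ^ 8"

definition A\<^sub>1 :: "real \<Rightarrow> real \<Rightarrow> real" where
  "A\<^sub>1 a y = y ^ 3 * ((1 - a * y ^ 2) / 180 - (1 / 64800 - a ^ 3 / 3) * y ^ 6 / 36)"

definition A\<^sub>2 :: "real \<Rightarrow> real \<Rightarrow> real" where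
  "A\<^sub>2 a y = - (y ^ 6 * ((1 - 2 * a * y ^ 2) / 32400))"

definition A\<^sub>3 :: "real \<Rightarrow> real" where
  "A\<^sub>3 y = y ^ 9 * (5 / 17496000)"

definition taylor :: "real \<Rightarrow> real \<Rightarrow> real \<Rightarrow> real" where
  "taylor a j y = A\<^sub>0 a y + j * A\<^sub>1 a y + j ^ 2 * A\<^sub>2 a y + j ^ 3 * A\<^sub>3 y"

lemma taylor_values:
  "taylor a 0 y = A\<^sub>0 a y"
  "taylor a 1 y = A\<^sub>0 a y + A\<^sub>1 a y + A\<^sub>2 a y + A\<^sub>3 y"
  "taylor a (-1) y = A\<^sub>0 a y - A\<^sub>1 a y + A\<^sub>2 a y - A\<^sub>3 y"
  "taylor a 2 y = A\<^sub>0 a y + 2 * A\<^sub>1 a y + 4 * A\<^sub>2 a y + 8 * A\<^sub>3 y"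
  "taylor a (-2) y = A\<^sub>0 a y - 2 * A\<^sub>1 a y + 4 * A\<^sub>2 a y - 8 * A\<^sub>3 y"
  by (simp_all add: taylor_def)

text \<open>\<open>freud6\<close> is invariant under reversal of its arguments, so the odd
  increments \<open>e\<close> and \<open>g\<close> enter only in pairs. With e of order y^3 and g of
  order y^9, only e^2 matters below y^12.\<close>

lemma freud6_symmetric:
  "freud6 (z - 2 * e + 4 * f - 8 * g) (z - e + f - g) z (z + e + f + g) (z + 2 * e + 4 * f + 8 * g)
   = z * (10 * z ^ 2 + 20 * z * f + 5 * e ^ 2 + 11 * f ^ 2 + 22 * e * g + 17 * g ^ 2)"
  unfolding freud6_def by algebra

text \<open>The estimate is reduced to an exact identity with right-hand side
  \<open>y ^ 10 * g y\<close>, where \<open>g\<close> is a polynomial collected by hand. In it A_0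
  is \<open>P + y^6 W\<close>, and \<open>d\<close>, \<open>f\<close>, \<open>e\<close> are the
  cofactors of y^3, y^6, y^9 in A_1, A_2, A_3.\<close>

lemma freud6_taylor:
  "(\<lambda>y. freud6 (taylor a (-2) y) (taylor a (-1) y) (taylor a 0 y) (taylor a 1 y) (taylor a 2 y)
      - (10 + 30 * a * y ^ 2 * taylor a 0 y)) \<in> O[at_right 0](\<lambda>y. y ^ 10)"
proof -
  define k l where "k = 1 / 64800 - a ^ 3 / 3" and "l = a ^ 4 / 3 - a / 97200"
  define P W p q d f :: "real \<Rightarrow> real"
    where "P y = 1 + a * y ^ 2" and "W y = k + l * y ^ 2" and "p y = (1 - a * y ^ 2) / 180"
      and "q y = k / 36" and "d y = p y - y ^ 6 * q y" and "f y = - ((1 - 2 * a * y ^ 2) / 32400)" for y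
  define e :: real where "e = 5 / 17496000"
  define g where "g y = 30 * (k * a ^ 2 + l * a) + 30 * l * a ^ 2 * y ^ 2 + (55 * a ^ 2 + 45 * a ^ 3 * y ^ 2) / 32400
     + y ^ 2 * (30 * P y * W y ^ 2 + 10 * W y ^ 3 * y ^ 6 + 40 * P y * W y * f y + 20 * W y ^ 2 * f y * y ^ 6
        + 5 * W y * d y ^ 2 - 10 * P y * p y * q y + 5 * P y * y ^ 6 * q y ^ 2
        + A\<^sub>0 a y * (11 * f y ^ 2 + 22 * d y * e + 17 * y ^ 6 * e ^ 2))" for y
  have eq: "freud6 (taylor a (-2) y) (taylor a (-1) y) (taylor a 0 y) (taylor a 1 y) (taylor a 2 y)
      - (10 + 30 * a * y ^ 2 * taylor a 0 y) = y ^ 10 * g y" for y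
  proof -
    have A: "A\<^sub>0 a y = P y + y ^ 6 * W y" "A\<^sub>1 a y = y ^ 3 * d y" "A\<^sub>2 a y = y ^ 6 * f y" "A\<^sub>3 y = y ^ 9 * e"
      by (simp_all add: A\<^sub>0_def A\<^sub>1_def A\<^sub>2_def A\<^sub>3_def P_def W_def p_def q_def d_def f_def e_def k_def l_def
          algebra_simps flip: power_add)
    let ?A = "A\<^sub>0 a y"
    have "freud6 (taylor a (-2) y) (taylor a (-1) y) (taylor a 0 y) (taylor a 1 y) (taylor a 2 y)
      - (10 + 30 * a * y ^ 2 * taylor a 0 y)
      = 10 * ?A ^ 3 + 20 * ?A ^ 2 * A\<^sub>2 a y + 5 * ?A * A\<^sub>1 a y ^ 2 - (10 + 30 * a * y ^ 2 * ?A)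
        + ?A * (11 * A\<^sub>2 a y ^ 2 + 22 * A\<^sub>1 a y * A\<^sub>3 y + 17 * A\<^sub>3 y ^ 2)"
      unfolding taylor_values freud6_symmetric by algebra
    also have "?A * (11 * A\<^sub>2 a y ^ 2 + 22 * A\<^sub>1 a y * A\<^sub>3 y + 17 * A\<^sub>3 y ^ 2)
      = y ^ 12 * (?A * (11 * f y ^ 2 + 22 * d y * e + 17 * y ^ 6 * e ^ 2))"
      unfolding A(2-4) by algebra
    also have "10 * ?A ^ 3 + 20 * ?A ^ 2 * A\<^sub>2 a y + 5 * ?A * A\<^sub>1 a y ^ 2 - (10 + 30 * a * y ^ 2 * ?A)
      = (10 * P y ^ 3 - 10 - 30 * a * y ^ 2 * P y) + y ^ 6 * (30 * W y * (P y ^ 2 - a * y ^ 2)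
         + (20 * P y ^ 2 * f y + 5 * P y * p y ^ 2))
        + y ^ 12 * (30 * P y * W y ^ 2 + 10 * W y ^ 3 * y ^ 6 + 40 * P y * W y * f y + 20 * W y ^ 2 * f y * y ^ 6
        + 5 * W y * d y ^ 2 - 10 * P y * p y * q y + 5 * P y * y ^ 6 * q y ^ 2)"
      unfolding A d_def by algebra
    \<comment> \<open>The y^2 and y^4 terms cancel, which is why the formal solution has no c^(-3)
      term.\<close>
    also have "10 * P y ^ 3 - 10 - 30 * a * y ^ 2 * P y = y ^ 6 * (10 * a ^ 3)"
      unfolding P_def by algebra
    also have "20 * P y ^ 2 * f y + 5 * P y * p y ^ 2
        = (- 15 - 5 * (a * y ^ 2) + 55 * (a * y ^ 2) ^ 2 + 45 * (a * y ^ 2) ^ 3) / 32400"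
      unfolding P_def p_def f_def by (simp add: field_simps power2_eq_square power3_eq_cube)
    also have "30 * W y * (P y ^ 2 - a * y ^ 2) + (- 15 - 5 * (a * y ^ 2) + 55 * (a * y ^ 2) ^ 2 + 45 * (a * y ^ 2) ^ 3) / 32400
      = - 10 * a ^ 3 + y ^ 4 * (30 * (k * a ^ 2 + l * a) + 30 * l * a ^ 2 * y ^ 2 + (55 * a ^ 2 + 45 * a ^ 3 * y ^ 2) / 32400)"
    proof -
      have 1: "30 * W y * (P y ^ 2 - a * y ^ 2) = 30 * k + 30 * (l + a * k) * y ^ 2
        + y ^ 4 * (30 * (k * a ^ 2 + l * a) + 30 * l * a ^ 2 * y ^ 2)"
        unfolding W_def P_def by algebra
      \<comment> \<open>These two equations determine \<open>k\<close> and \<open>l\<close>: 10 a^3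
        + 30 k - 15/32400 is the coefficient of y^6 in the residual, and 30 (l + a k) - 5 a/32400
        that of y^8.\<close>
      have 2: "30 * k = 15 / 32400 - 10 * a ^ 3" "30 * (l + a * k) = 5 * a / 32400"
        unfolding k_def l_def by (simp_all add: field_simps eval_nat_numeral)
      show ?thesis
        unfolding 1 2 by algebra
    qed
    finally show ?thesis unfolding g_def by algebra
  qed
  have "isCont P 0" "isCont W 0" "isCont p 0" "isCont q 0" "isCont d 0" "isCont f 0" "isCont (A\<^sub>0 a) 0"
    unfolding P_def W_def p_def q_def d_def f_def A\<^sub>0_def by (auto intro!: continuous_intros)
  then have "isCont g 0"
    unfolding g_def by (auto intro!: continuous_intros)
  then show ?thesis
    unfolding eq by (rule bigo_at_right_power)
qed

text \<open>This is \<open>- 2 y^4\<close> times the claimed expansion of \<open>p(n, t)\<close>, with \<open>a = t / 90\<close> and \<open>y = (n / 60) powr (-1/3)\<close>.\<close>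

definition subleading_expansion :: "real \<Rightarrow> real \<Rightarrow> real" where
  "subleading_expansion a y = 90 + 180 * a * y ^ 2 - y ^ 3 + 180 * a ^ 2 * y ^ 4 - a * y ^ 5
     + (60 * a ^ 3 - 1 / 540) * y ^ 6 - 30 * a ^ 4 * y ^ 8 + (a ^ 3 / 3 - 1 / 64800) * y ^ 9"

text \<open>This is \<open>subleading_coeff_eq\<close> divided by - c^4/2: as n = 60 c^3, the factor
  n - 1 turns into 60 - y^3 there. The method is that of \<open>freud6_taylor\<close>.\<close>

lemma subleading_taylor:
  "(\<lambda>y. (60 - y ^ 3) * taylor a 0 y + 6 * taylor a 1 y * taylor a 0 y * taylor a (-1) y
      * (taylor a (-2) y + taylor a (-1) y + taylor a 0 y + taylor a 1 y + taylor a 2 y)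
      - subleading_expansion a y) \<in> O[at_right 0](\<lambda>y. y ^ 10)"
proof -
  define k l where "k = 1 / 64800 - a ^ 3 / 3" and "l = a ^ 4 / 3 - a / 97200"
  define P W p q d f :: "real \<Rightarrow> real"
    where "P y = 1 + a * y ^ 2" and "W y = k + l * y ^ 2" and "p y = (1 - a * y ^ 2) / 180"
      and "q y = k / 36" and "d y = p y - y ^ 6 * q y" and "f y = - ((1 - 2 * a * y ^ 2) / 32400)" for y
  define e :: real where "e = 5 / 17496000"
  define g where "g y = 360 * k * a ^ 2 + 120 * k * a ^ 3 * y ^ 2 + l * (360 * a + 360 * a ^ 2 * y ^ 2 + 120 * a ^ 3 * y ^ 4)
     + (420 * a ^ 2 + 600 * a ^ 3 * y ^ 2 + 210 * a ^ 4 * y ^ 4) / 32400 - l * y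
     + y ^ 2 * (180 * P y ^ 2 * W y ^ 2 + 120 * P y * W y ^ 3 * y ^ 6 + 30 * W y ^ 4 * y ^ 12
        + 120 * (3 * P y ^ 2 * W y + 3 * P y * W y ^ 2 * y ^ 6 + W y ^ 3 * y ^ 12) * f y
        - 30 * ((2 * P y * W y + y ^ 6 * W y ^ 2) * d y ^ 2 + P y ^ 2 * (- 2 * p y * q y + y ^ 6 * q y ^ 2))
        + 30 * A\<^sub>0 a y * (5 * A\<^sub>0 a y * f y ^ 2 + 2 * y ^ 6 * f y ^ 3 - 2 * f y * (d y + y ^ 6 * e) ^ 2
           - A\<^sub>0 a y * (2 * d y * e + y ^ 6 * e ^ 2)))" for y
  have eq: "(60 - y ^ 3) * taylor a 0 y + 6 * taylor a 1 y * taylor a 0 y * taylor a (-1) y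
      * (taylor a (-2) y + taylor a (-1) y + taylor a 0 y + taylor a 1 y + taylor a 2 y)
      - subleading_expansion a y = y ^ 10 * g y" for y
  proof -
    have A: "A\<^sub>0 a y = P y + y ^ 6 * W y" "A\<^sub>1 a y = y ^ 3 * d y" "A\<^sub>2 a y = y ^ 6 * f y" "A\<^sub>3 y = y ^ 9 * e"
      by (simp_all add: A\<^sub>0_def A\<^sub>1_def A\<^sub>2_def A\<^sub>3_def P_def W_def p_def q_def d_def f_def e_def k_def l_def
          algebra_simps flip: power_add)
    let ?A = "A\<^sub>0 a y"
    have k_minus: "a ^ 3 / 3 - 1 / 64800 = - k"
      by (simp add: k_def)
    let ?f = "A\<^sub>2 a y" and ?d = "A\<^sub>1 a y" and ?e = "A\<^sub>3 y"
    have "(60 - y ^ 3) * taylor a 0 y + 6 * taylor a 1 y * taylor a 0 y * taylor a (-1) y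
      * (taylor a (-2) y + taylor a (-1) y + taylor a 0 y + taylor a 1 y + taylor a 2 y)
      = 30 * ?A ^ 4 + 60 * ?A + 120 * ?A ^ 3 * ?f - 30 * ?A ^ 2 * ?d ^ 2 - y ^ 3 * ?A
        + 30 * ?A * (5 * ?A * ?f ^ 2 + 2 * ?f ^ 3 - 2 * ?f * (?d + ?e) ^ 2 - ?A * (2 * ?d * ?e + ?e ^ 2))"
      unfolding taylor_values by algebra
    also have "30 * ?A * (5 * ?A * ?f ^ 2 + 2 * ?f ^ 3 - 2 * ?f * (?d + ?e) ^ 2 - ?A * (2 * ?d * ?e + ?e ^ 2))
      = y ^ 12 * (30 * ?A * (5 * ?A * f y ^ 2 + 2 * y ^ 6 * f y ^ 3 - 2 * f y * (d y + y ^ 6 * e) ^ 2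
           - ?A * (2 * d y * e + y ^ 6 * e ^ 2)))"
      unfolding A(2-4) by algebra
    also have "30 * ?A ^ 4 + 60 * ?A + 120 * ?A ^ 3 * ?f - 30 * ?A ^ 2 * ?d ^ 2 - y ^ 3 * ?A
      = (30 * P y ^ 4 + 60 * P y - y ^ 3 * (P y + y ^ 6 * W y)) + y ^ 6 * (W y * (120 * P y ^ 3 + 60)
         + (120 * P y ^ 3 * f y - 30 * P y ^ 2 * p y ^ 2))
        + y ^ 12 * (180 * P y ^ 2 * W y ^ 2 + 120 * P y * W y ^ 3 * y ^ 6 + 30 * W y ^ 4 * y ^ 12
        + 120 * (3 * P y ^ 2 * W y + 3 * P y * W y ^ 2 * y ^ 6 + W y ^ 3 * y ^ 12) * f y
        - 30 * ((2 * P y * W y + y ^ 6 * W y ^ 2) * d y ^ 2 + P y ^ 2 * (- 2 * p y * q y + y ^ 6 * q y ^ 2)))"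
      unfolding A d_def by algebra
    also have "30 * P y ^ 4 + 60 * P y - y ^ 3 * (P y + y ^ 6 * W y)
      = 90 + 180 * a * y ^ 2 - y ^ 3 + 180 * a ^ 2 * y ^ 4 - a * y ^ 5 + 120 * a ^ 3 * y ^ 6 + 30 * a ^ 4 * y ^ 8
        - k * y ^ 9 - y ^ 11 * l"
      unfolding P_def W_def by algebra
    also have "W y * (120 * P y ^ 3 + 60) = 180 * k + (180 * l + 360 * a * k) * y ^ 2
      + y ^ 4 * (360 * k * a ^ 2 + 120 * k * a ^ 3 * y ^ 2 + l * (360 * a + 360 * a ^ 2 * y ^ 2 + 120 * a ^ 3 * y ^ 4))"
      unfolding P_def W_def by algebra
    also have "120 * P y ^ 3 * f y - 30 * P y ^ 2 * p y ^ 2 = - 1 / 216 - a / 270 * y ^ 2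
        + y ^ 4 * ((420 * a ^ 2 + 600 * a ^ 3 * y ^ 2 + 210 * a ^ 4 * y ^ 4) / 32400)"
      unfolding P_def p_def f_def by (simp add: field_simps eval_nat_numeral)
    also have "180 * k + (180 * l + 360 * a * k) * y ^ 2
      + y ^ 4 * (360 * k * a ^ 2 + 120 * k * a ^ 3 * y ^ 2 + l * (360 * a + 360 * a ^ 2 * y ^ 2 + 120 * a ^ 3 * y ^ 4))
      + (- 1 / 216 - a / 270 * y ^ 2 + y ^ 4 * ((420 * a ^ 2 + 600 * a ^ 3 * y ^ 2 + 210 * a ^ 4 * y ^ 4) / 32400))
      = - 1 / 540 - 60 * a ^ 3 - 60 * a ^ 4 * y ^ 2
      + y ^ 4 * (360 * k * a ^ 2 + 120 * k * a ^ 3 * y ^ 2 + l * (360 * a + 360 * a ^ 2 * y ^ 2 + 120 * a ^ 3 * y ^ 4)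
        + (420 * a ^ 2 + 600 * a ^ 3 * y ^ 2 + 210 * a ^ 4 * y ^ 4) / 32400)"
    proof -
      \<comment> \<open>The multiples a/270 of y^2 cancel, so the y^8 term of the expansion involves
        a^4 alone; 1/360 - 1/216 = - 1/540 gives the constant in its y^6 term.\<close>
      have *: "180 * k = 1 / 360 - 60 * a ^ 3" "180 * l + 360 * a * k = a / 270 - 60 * a ^ 4"
        unfolding k_def l_def by (simp_all add: field_simps eval_nat_numeral)
      show ?thesis
        unfolding * by (simp add: algebra_simps)
    qed
    also have "90 + 180 * a * y ^ 2 - y ^ 3 + 180 * a ^ 2 * y ^ 4 - a * y ^ 5 + 120 * a ^ 3 * y ^ 6 + 30 * a ^ 4 * y ^ 8
        - k * y ^ 9 - y ^ 11 * l + y ^ 6 * (- 1 / 540 - 60 * a ^ 3 - 60 * a ^ 4 * y ^ 2 + y ^ 4 * u) + y ^ 12 * v + y ^ 12 * w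
      = 90 + 180 * a * y ^ 2 - y ^ 3 + 180 * a ^ 2 * y ^ 4 - a * y ^ 5 + (60 * a ^ 3 - 1 / 540) * y ^ 6 - 30 * a ^ 4 * y ^ 8
        + - k * y ^ 9 + y ^ 10 * (u - l * y + y ^ 2 * (v + w))" for u v w
      by (simp add: algebra_simps eval_nat_numeral)
    finally have "(60 - y ^ 3) * taylor a 0 y + 6 * taylor a 1 y * taylor a 0 y * taylor a (-1) y
      * (taylor a (-2) y + taylor a (-1) y + taylor a 0 y + taylor a 1 y + taylor a 2 y)
      = subleading_expansion a y + y ^ 10 * g y"
      unfolding g_def subleading_expansion_def k_minus .
    then show ?thesis by simp
  qed
  have "isCont P 0" "isCont W 0" "isCont p 0" "isCont q 0" "isCont d 0" "isCont f 0" "isCont (A\<^sub>0 a) 0"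
    unfolding P_def W_def p_def q_def d_def f_def A\<^sub>0_def by (auto intro!: continuous_intros)
  then have "isCont g 0"
    unfolding g_def by (auto intro!: continuous_intros)
  then show ?thesis
    unfolding eq by (rule bigo_at_right_power)
qed

section \<open>The formal solution at shifted arguments\<close>

definition b_approx :: "real \<Rightarrow> real \<Rightarrow> real" where
  "b_approx a x = cbrt60 x + a / cbrt60 x + (1 / 64800 - a ^ 3 / 3) / cbrt60 x ^ 5
     + (a ^ 4 / 3 - a / 97200) / cbrt60 x ^ 7"

lemma bigo_inverse_cbrt60_power_mono:
  assumes "m \<le> k"
  shows "(\<lambda>x. (1 / cbrt60 x) ^ k) \<in> O(\<lambda>x. (1 / cbrt60 x) ^ m)"
proof (rule bigoI)
  have "eventually (\<lambda>x. 1 / cbrt60 x < 1) at_top" "eventually (\<lambda>x. 0 < 1 / cbrt60 x) at_top"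
    unfolding cbrt60_def by real_asymp+
  then show "eventually (\<lambda>x. norm ((1 / cbrt60 x) ^ k) \<le> 1 * norm ((1 / cbrt60 x) ^ m)) at_top"
    by eventually_elim (use assms in \<open>simp add: power_decreasing power_abs del: power_one_over power_divide\<close>)
qed

text \<open>Since j/x = (j/60) y^3, an order k in j/x is an order 3 k in y. The value
  \<open>r 0 = 0\<close> covers \<open>j = 0\<close>, about which the punctured filter
  \<open>at 0\<close> says nothing.\<close>

lemma bigo_shift_ratio:
  fixes r :: "real \<Rightarrow> real"
  assumes "r \<in> O[at 0](\<lambda>z. z ^ k)" "r 0 = 0"
  shows "(\<lambda>x. r (j / x)) \<in> O(\<lambda>x. (1 / cbrt60 x) ^ (3 * k))"
proof (cases "j = 0")
  case False
  have "filterlim (\<lambda>x. j / x) (at 0) at_top"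
    unfolding filterlim_at
    using False by (auto intro!: tendsto_divide_0 filterlim_ident filterlim_at_top_imp_at_infinity
        eventually_mono[OF eventually_gt_at_top[of 0]])
  then have "(\<lambda>x. r (j / x)) \<in> O(\<lambda>x. (j / x) ^ k)"
    by (rule landau_o.big.compose[OF assms(1)])
  also have "(\<lambda>x. (j / x) ^ k) \<in> O(\<lambda>x. (1 / cbrt60 x) ^ (3 * k))"
  proof (rule bigoI)
    show "eventually (\<lambda>x. norm ((j / x) ^ k) \<le> \<bar>j / 60\<bar> ^ k * norm ((1 / cbrt60 x) ^ (3 * k))) at_top"
      using eventually_gt_at_top[of 0]
    proof eventually_elim
      case (elim x)
      have "j / x = j / 60 * (1 / cbrt60 x) ^ 3"
        using cbrt60_cube[OF elim] elim by (simp add: power_one_over)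
      then have "(j / x) ^ k = (j / 60) ^ k * (1 / cbrt60 x) ^ (3 * k)"
        by (simp only: power_mult_distrib power_mult)
      then show ?case by (simp add: abs_mult power_abs)
    qed
  qed
  finally show ?thesis .
qed (use assms in simp)

lemma b_approx_shift:
  "(\<lambda>x. b_approx a (x + j) / cbrt60 x - taylor a j (1 / cbrt60 x)) \<in> O(\<lambda>x. (1 / cbrt60 x) ^ 10)"
proof -
  define k l where "k = 1 / 64800 - a ^ 3 / 3" and "l = a ^ 4 / 3 - a / 97200"
  define \<rho> :: "real \<Rightarrow> real" where "\<rho> z = (1 + z) powr (1/3)" for z
  \<comment> \<open>Remainders of the binomial series of (1 + z)^(m/3) for m = 1, -1, -5, -7. Their
    orders 4, 3, 2, 1 in z, tripled and added to the prefactors y^0, y^2, y^6, y^8, all reach at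
    least y^10.\<close>
  define r1 where "r1 z = \<rho> z - (1 + z / 3 - z ^ 2 / 9 + 5 * z ^ 3 / 81)" for z
  define r2 where "r2 z = 1 / \<rho> z - (1 - z / 3 + 2 * z ^ 2 / 9)" for z
  define r3 where "r3 z = 1 / \<rho> z ^ 5 - (1 - 5 * z / 3)" for z
  define r4 where "r4 z = 1 / \<rho> z ^ 7 - 1" for z
  have r: "r1 \<in> O[at 0](\<lambda>z. z ^ 4)" "r2 \<in> O[at 0](\<lambda>z. z ^ 3)" "r3 \<in> O[at 0](\<lambda>z. z ^ 2)" "r4 \<in> O[at 0](\<lambda>z. z ^ 1)"
    unfolding r1_def r2_def r3_def r4_def \<rho>_def by real_asymp+
  have r0: "r1 0 = 0" "r2 0 = 0" "r3 0 = 0" "r4 0 = 0"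
    by (simp_all add: r1_def r2_def r3_def r4_def \<rho>_def)
  have bigo: "(\<lambda>x. c * (1 / cbrt60 x) ^ m * r (j / x)) \<in> O(\<lambda>x. (1 / cbrt60 x) ^ 10)"
    if "r \<in> O[at 0](\<lambda>z. z ^ n)" "r 0 = 0" "10 \<le> m + 3 * n" for c m n and r :: "real \<Rightarrow> real"
  proof -
    have "(\<lambda>x. c * (1 / cbrt60 x) ^ m * r (j / x)) \<in> O(\<lambda>x. (1 / cbrt60 x) ^ m * (1 / cbrt60 x) ^ (3 * n))"
      using bigo_shift_ratio[OF that(1,2), of j] by (intro landau_o.big.mult) auto
    also have "(\<lambda>x. (1 / cbrt60 x) ^ m * (1 / cbrt60 x) ^ (3 * n)) \<in> O(\<lambda>x. (1 / cbrt60 x) ^ 10)"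
      using bigo_inverse_cbrt60_power_mono[OF that(3)] by (simp only: power_add)
    finally show ?thesis .
  qed
  have "eventually (\<lambda>x. b_approx a (x + j) / cbrt60 x - taylor a j (1 / cbrt60 x)
      = 1 * (1 / cbrt60 x) ^ 0 * r1 (j / x) + a * (1 / cbrt60 x) ^ 2 * r2 (j / x)
        + k * (1 / cbrt60 x) ^ 6 * r3 (j / x) + l * (1 / cbrt60 x) ^ 8 * r4 (j / x)) at_top"
    using eventually_gt_at_top[of 0] eventually_gt_at_top[of "- j"]
  proof eventually_elim
    case (elim x)
    define c where "c = cbrt60 x"
    define y where "y = 1 / c"
    define z where "z = j / x"
    have c: "c > 0" "c * y = 1" using cbrt60_pos[OF elim(1)] by (simp_all add: c_def y_def)
    have "z > - 1" using elim by (simp add: z_def field_simps)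
    then have \<rho>: "\<rho> z > 0" by (simp add: \<rho>_def)
    have shift: "cbrt60 (x + j) = c * \<rho> z"
      using cbrt60_shift[of x j] elim by (simp add: c_def \<rho>_def z_def)
    have "x = 60 * c ^ 3" using cbrt60_cube[OF elim(1)] by (simp add: c_def)
    then have z: "z = j * y ^ 3 / 60"
      using c(1) by (simp add: z_def y_def power_one_over)
    have "b_approx a (x + j) / c = \<rho> z + a * y ^ 2 * (1 / \<rho> z) + k * y ^ 6 * (1 / \<rho> z ^ 5) + l * y ^ 8 * (1 / \<rho> z ^ 7)"
      unfolding b_approx_def shift k_def[symmetric] l_def[symmetric] y_def
      using c(1) \<rho> by (simp add: field_simps eval_nat_numeral)
    moreover have "taylor a j y = (1 + z / 3 - z ^ 2 / 9 + 5 * z ^ 3 / 81) + a * y ^ 2 * (1 - z / 3 + 2 * z ^ 2 / 9)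
        + k * y ^ 6 * (1 - 5 * z / 3) + l * y ^ 8 * 1"
      unfolding taylor_def A\<^sub>0_def A\<^sub>1_def A\<^sub>2_def A\<^sub>3_def k_def[symmetric] l_def[symmetric] z
      by (simp add: field_simps eval_nat_numeral)
    ultimately have "b_approx a (x + j) / c - taylor a j y
      = r1 z + a * y ^ 2 * r2 z + k * y ^ 6 * r3 z + l * y ^ 8 * r4 z"
      unfolding r1_def r2_def r3_def r4_def by (simp only: right_diff_distrib)
    then show ?case unfolding c_def y_def z_def by simp
  qed
  moreover have "(\<lambda>x. 1 * (1 / cbrt60 x) ^ 0 * r1 (j / x) + a * (1 / cbrt60 x) ^ 2 * r2 (j / x)
        + k * (1 / cbrt60 x) ^ 6 * r3 (j / x) + l * (1 / cbrt60 x) ^ 8 * r4 (j / x)) \<in> O(\<lambda>x. (1 / cbrt60 x) ^ 10)"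
    by (intro sum_in_bigo(1) bigo[OF r(1) r0(1)] bigo[OF r(2) r0(2)] bigo[OF r(3) r0(3)] bigo[OF r(4) r0(4)])
       simp_all
  ultimately show ?thesis
    by (rule landau_o.big.in_cong[THEN iffD2])
qed

section \<open>Comparison with the formal solution\<close>

text \<open>Boundedness of both functions is included to make the relation compatible with products;
  an error of order \<open>e\<close> then passes through every polynomial expression.\<close>

definition bigo_close :: "'a filter \<Rightarrow> ('a \<Rightarrow> real) \<Rightarrow> ('a \<Rightarrow> real) \<Rightarrow> ('a \<Rightarrow> real) \<Rightarrow> bool" where
  "bigo_close F e f g \<longleftrightarrow> (\<lambda>x. f x - g x) \<in> O[F](e) \<and> f \<in> O[F](\<lambda>_. 1) \<and> g \<in> O[F](\<lambda>_. 1)"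

lemma bigo_close_const: "bigo_close F e (\<lambda>_. c) (\<lambda>_. c)"
  by (simp add: bigo_close_def)

lemma bigo_close_refl: "f \<in> O[F](\<lambda>_. 1) \<Longrightarrow> bigo_close F e f f"
  by (simp add: bigo_close_def)

lemma bigo_close_add:
  assumes "bigo_close F e f f'" "bigo_close F e g g'"
  shows "bigo_close F e (\<lambda>x. f x + g x) (\<lambda>x. f' x + g' x)"
proof -
  have "(\<lambda>x. (f x - f' x) + (g x - g' x)) \<in> O[F](e)"
    using assms by (intro sum_in_bigo(1)) (auto simp: bigo_close_def)
  moreover have "(\<lambda>x. (f x - f' x) + (g x - g' x)) = (\<lambda>x. f x + g x - (f' x + g' x))"
    by auto
  ultimately show ?thesis
    using assms by (auto simp: bigo_close_def intro: sum_in_bigo)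
qed

lemma bigo_close_mult:
  assumes "bigo_close F e f f'" "bigo_close F e g g'"
  shows "bigo_close F e (\<lambda>x. f x * g x) (\<lambda>x. f' x * g' x)"
proof -
  have *: "(\<lambda>x. u x * v x) \<in> O[F](\<lambda>x. w x)" if "u \<in> O[F](w)" "v \<in> O[F](\<lambda>_. 1)" for u v w :: "'a \<Rightarrow> real"
    using landau_o.big.mult[OF that] by simp
  have "(\<lambda>x. (f x - f' x) * g x + (g x - g' x) * f' x) \<in> O[F](e)"
    using assms by (intro sum_in_bigo(1) *) (auto simp: bigo_close_def)
  moreover have "(\<lambda>x. (f x - f' x) * g x + (g x - g' x) * f' x) = (\<lambda>x. f x * g x - f' x * g' x)"
    by (auto simp: algebra_simps)
  ultimately show ?thesis
    using assms by (auto simp: bigo_close_def intro: *)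
qed

lemma bigo_close_trans:
  assumes "bigo_close F e f g" "bigo_close F e g h"
  shows "bigo_close F e f h"
proof -
  have "(\<lambda>x. (f x - g x) + (g x - h x)) \<in> O[F](e)"
    using assms by (intro sum_in_bigo(1)) (auto simp: bigo_close_def)
  then show ?thesis using assms by (auto simp: bigo_close_def)
qed

lemma bigo_close_freud6:
  assumes "bigo_close F e p p'" "bigo_close F e q q'" "bigo_close F e z z'" "bigo_close F e r r'" "bigo_close F e s s'"
  shows "bigo_close F e (\<lambda>x. freud6 (p x) (q x) (z x) (r x) (s x)) (\<lambda>x. freud6 (p' x) (q' x) (z' x) (r' x) (s' x))"
  unfolding freud6_def power2_eq_square
  by (intro bigo_close_mult bigo_close_add bigo_close_const assms)

lemma cbrt60_normalize_shift:
  assumes "n > 0"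
  shows "b / cbrt60 (real (n + 2)) = b / cbrt60 (real (n + j)) * (cbrt60 (real (n + j)) / cbrt60 (real (n + 2)))"
  using assms cbrt60_pos[of "real (n + j)"] by simp

lemma normalized_shift_tendsto:
  fixes b :: "nat \<Rightarrow> real"
  assumes "(\<lambda>n. b n / cbrt60 (real n)) \<longlonglongrightarrow> 1"
  shows "(\<lambda>n. b (n + j) / cbrt60 (real (n + 2))) \<longlonglongrightarrow> 1"
proof -
  have "(\<lambda>n. b (n + j) / cbrt60 (real (n + j)) * (cbrt60 (real (n + j)) / cbrt60 (real (n + 2)))) \<longlonglongrightarrow> 1 * 1"
    using LIMSEQ_ignore_initial_segment[OF assms, of j] by (intro tendsto_mult cbrt60_ratio_tendsto)
  then have "(\<lambda>n. b (n + j) / cbrt60 (real (n + j)) * (cbrt60 (real (n + j)) / cbrt60 (real (n + 2)))) \<longlonglongrightarrow> 1"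
    by simp
  then show ?thesis
    by (rule Lim_transform_eventually)
       (use eventually_gt_at_top[of 0] in eventually_elim, rule cbrt60_normalize_shift[symmetric], simp)
qed

lemma inverse_cbrt60_seq: "filterlim (\<lambda>n. 1 / cbrt60 (real (n + 2))) (at_right 0) sequentially"
  unfolding cbrt60_def by real_asymp

lemma bigo_1_if_tendsto: "(f \<longlongrightarrow> (c::real)) F \<Longrightarrow> f \<in> O[F](\<lambda>_. 1)"
  by (rule bigoI_tendsto[where c = c]) auto

lemma taylor_tendsto: "((\<lambda>n. taylor a j (1 / cbrt60 (real (n + 2)))) \<longlongrightarrow> 1) sequentially"
proof -
  have "(taylor a j \<longlongrightarrow> taylor a j 0) (at 0)"
    unfolding taylor_def A\<^sub>0_def A\<^sub>1_def A\<^sub>2_def A\<^sub>3_def by (intro tendsto_intros) auto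
  then have "(taylor a j \<longlongrightarrow> taylor a j 0) (at_right 0)"
    by (simp add: filterlim_at_split)
  from filterlim_compose[OF this inverse_cbrt60_seq] show ?thesis
    by (simp add: taylor_def A\<^sub>0_def A\<^sub>1_def A\<^sub>2_def A\<^sub>3_def)
qed

lemma b_approx_tendsto: "(\<lambda>n. b_approx a (real n) / cbrt60 (real n)) \<longlonglongrightarrow> 1"
  unfolding b_approx_def cbrt60_def by real_asymp

lemma b_approx_close_taylor:
  "bigo_close sequentially (\<lambda>n. (1 / cbrt60 (real (n + 2))) ^ 10)
     (\<lambda>n. b_approx a (real (n + j)) / cbrt60 (real (n + 2))) (\<lambda>n. taylor a (real j - 2) (1 / cbrt60 (real (n + 2))))"
  unfolding bigo_close_def
proof (intro conjI)
  have "filterlim (\<lambda>n. real (n + 2)) at_top sequentially"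
    by real_asymp
  from landau_o.big.compose[OF b_approx_shift[of a "real j - 2"] this]
  show "(\<lambda>n. b_approx a (real (n + j)) / cbrt60 (real (n + 2)) - taylor a (real j - 2) (1 / cbrt60 (real (n + 2))))
    \<in> O(\<lambda>n. (1 / cbrt60 (real (n + 2))) ^ 10)"
    by (simp add: add_ac)
  show "(\<lambda>n. b_approx a (real (n + j)) / cbrt60 (real (n + 2))) \<in> O(\<lambda>_. 1)"
    by (rule bigo_1_if_tendsto, rule normalized_shift_tendsto, rule b_approx_tendsto)
  show "(\<lambda>n. taylor a (real j - 2) (1 / cbrt60 (real (n + 2)))) \<in> O(\<lambda>_. 1)"
    by (rule bigo_1_if_tendsto, rule taylor_tendsto)
qed

text \<open>The residual is polynomial in the entries and in y, so replacing the shifted values of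
  \<open>b_approx\<close> by \<open>taylor\<close> changes it by O(y^10), and
  \<open>freud6_taylor\<close> applies.\<close>

lemma b_approx_residual:
  fixes a :: real
  defines "Y \<equiv> \<lambda>j n. b_approx a (real (n + j)) / cbrt60 (real (n + 2))"
  shows "(\<lambda>n. freud6 (Y 0 n) (Y 1 n) (Y 2 n) (Y 3 n) (Y 4 n)
      - (10 + 30 * a * (1 / cbrt60 (real (n + 2))) ^ 2 * Y 2 n)) \<in> O(\<lambda>n. (1 / cbrt60 (real (n + 2))) ^ 10)"
    (is "_ \<in> O(?e)")
proof -
  define y where "y n = 1 / cbrt60 (real (n + 2))" for n
  define U where "U j n = taylor a j (y n)" for j n
  have YU: "bigo_close sequentially ?e (Y j) (U (real j - 2))" for j
    unfolding Y_def U_def y_def by (rule b_approx_close_taylor)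
  have YU': "bigo_close sequentially ?e (Y 0) (U (-2))" "bigo_close sequentially ?e (Y 1) (U (-1))"
      "bigo_close sequentially ?e (Y 2) (U 0)" "bigo_close sequentially ?e (Y 3) (U 1)" "bigo_close sequentially ?e (Y 4) (U 2)"
    using YU[of 0] YU[of 1] YU[of 2] YU[of 3] YU[of 4] by simp_all
  have "y \<longlonglongrightarrow> 0"
    unfolding y_def cbrt60_def by real_asymp
  then have y: "bigo_close sequentially ?e y y"
    by (intro bigo_close_refl bigo_1_if_tendsto)
  have 1: "bigo_close sequentially ?e (\<lambda>n. freud6 (Y 0 n) (Y 1 n) (Y 2 n) (Y 3 n) (Y 4 n))
     (\<lambda>n. freud6 (U (-2) n) (U (-1) n) (U 0 n) (U 1 n) (U 2 n))"
    by (intro bigo_close_freud6 YU')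
  have 2: "bigo_close sequentially ?e (\<lambda>n. 10 + 30 * a * y n ^ 2 * Y 2 n) (\<lambda>n. 10 + 30 * a * y n ^ 2 * U 0 n)"
    unfolding power2_eq_square by (intro bigo_close_add bigo_close_mult bigo_close_const y YU')
  have 3: "(\<lambda>n. freud6 (U (-2) n) (U (-1) n) (U 0 n) (U 1 n) (U 2 n) - (10 + 30 * a * y n ^ 2 * U 0 n)) \<in> O(?e)"
    unfolding U_def y_def using landau_o.big.compose[OF freud6_taylor inverse_cbrt60_seq] .
  have "(\<lambda>n. (freud6 (Y 0 n) (Y 1 n) (Y 2 n) (Y 3 n) (Y 4 n) - freud6 (U (-2) n) (U (-1) n) (U 0 n) (U 1 n) (U 2 n))
     - ((10 + 30 * a * y n ^ 2 * Y 2 n) - (10 + 30 * a * y n ^ 2 * U 0 n))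
     + (freud6 (U (-2) n) (U (-1) n) (U 0 n) (U 1 n) (U 2 n) - (10 + 30 * a * y n ^ 2 * U 0 n))) \<in> O(?e)"
    by (rule sum_in_bigo(1)[OF sum_in_bigo(2) 3]) (use 1 2 in \<open>simp_all only: bigo_close_def\<close>)
  then show ?thesis unfolding y_def by (simp add: algebra_simps)
qed

text \<open>Since 450 = 60^2/8, \<open>root 3 450\<close> is half the square of
  \<open>root 3 60\<close>. With x = 60 c^3 all radicals cancel, leaving a polynomial in c and
  1/c.\<close>

lemma subleading_expansion_eq:
  assumes "x > 0"
  shows "- (3 * x powr (4/3)) / (4 * root 3 60)
            - x powr (2/3) * t / (2 * root 3 450)
            + x powr (1/3) / (2 * root 3 60)
            - t ^ 2 / 90
            + t / (6 * root 3 450 * x powr (1/3))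
            - (2 * t ^ 3 - 45) / (810 * root 3 60 * x powr (2/3))
            + t ^ 4 / (2430 * root 3 450 * x powr (4/3))
            - (4 * t ^ 3 - 135) / (4860 * root 3 60 * x powr (5/3))
    = - (cbrt60 x ^ 4 * subleading_expansion (t / 90) (1 / cbrt60 x)) / 2"
proof -
  define \<rho> c where "\<rho> = root 3 60" and "c = cbrt60 x"
  have \<rho>: "\<rho> > 0" "\<rho> ^ 3 = 60" by (simp_all add: \<rho>_def)
  have c: "c > 0" using assms by (simp add: c_def cbrt60_pos)
  have "(\<rho> ^ 2 / 2) ^ 3 = (\<rho> ^ 3) ^ 2 / 8"
    by (simp add: power_divide flip: power_mult)
  then have "root 3 450 = root 3 ((\<rho> ^ 2 / 2) ^ 3)"
    using \<rho>(2) by simp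
  also have "\<dots> = \<rho> ^ 2 / 2" using \<rho> by (intro real_root_power_cancel) auto
  finally have root450: "root 3 450 = \<rho> ^ 2 / 2" .
  have x: "x powr (1/3) = \<rho> * c"
    using assms by (simp add: \<rho>_def c_def cbrt60_def root_powr_inverse powr_divide)
  have xk: "x powr (real k / 3) = \<rho> ^ k * c ^ k" for k
  proof -
    have "x powr (real k / 3) = (x powr (1/3)) ^ k"
      using assms by (simp add: powr_power)
    then show ?thesis by (simp add: x power_mult_distrib)
  qed
  have p: "\<rho> ^ 4 = 60 * \<rho>" "\<rho> ^ 5 = 60 * \<rho> ^ 2" "\<rho> * \<rho> ^ 2 = 60" 
    using \<rho>(2) by (simp_all add: eval_nat_numeral)
  have powrs: "x powr (2/3) = \<rho> ^ 2 * c ^ 2" "x powr (4/3) = 60 * \<rho> * c ^ 4" "x powr (5/3) = 60 * \<rho> ^ 2 * c ^ 5"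
    using xk[of 2] xk[of 4] xk[of 5] by (simp_all add: p)
  have terms: "3 * (60 * \<rho> * c ^ 4) / (4 * \<rho>) = 45 * c ^ 4"
    "\<rho> ^ 2 * c ^ 2 * t / (2 * (\<rho> ^ 2 / 2)) = c ^ 2 * t"
    "\<rho> * c / (2 * \<rho>) = c / 2"
    "6 * (\<rho> ^ 2 / 2) * (\<rho> * c) = 180 * c"
    "810 * \<rho> * (\<rho> ^ 2 * c ^ 2) = 48600 * c ^ 2"
    "2430 * (\<rho> ^ 2 / 2) * (60 * \<rho> * c ^ 4) = 4374000 * c ^ 4"
    "4860 * \<rho> * (60 * \<rho> ^ 2 * c ^ 5) = 17496000 * c ^ 5"
    using \<rho> p(3) by (simp_all add: field_simps) 
  define y where "y = 1 / c"
  have "c * y = 1" using c by (simp add: y_def)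
  then have reduce: "c ^ 4 * (y ^ 2 * w) = c ^ 2 * w" "c ^ 4 * (y ^ 3 * w) = c * w" "c ^ 4 * (y ^ 4 * w) = w"
    "c ^ 4 * (y ^ 5 * w) = y * w" "c ^ 4 * (y ^ 6 * w) = y ^ 2 * w" "c ^ 4 * (y ^ 8 * w) = y ^ 4 * w"
    "c ^ 4 * (y ^ 9 * w) = y ^ 5 * w" for w
    by algebra+
  have quotients: "u / (v * c) = u / v * y" "u / (v * c ^ m) = u / v * y ^ m" for u v m
    by (simp_all add: y_def power_one_over)
  have "c ^ 4 * subleading_expansion (t / 90) y
   = 90 * c ^ 4 + c ^ 4 * (y ^ 2 * (2 * t)) - c ^ 4 * (y ^ 3 * 1) + c ^ 4 * (y ^ 4 * (t ^ 2 / 45))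
     - c ^ 4 * (y ^ 5 * (t / 90)) + c ^ 4 * (y ^ 6 * ((2 * t ^ 3 - 45) / 24300))
     - c ^ 4 * (y ^ 8 * (t ^ 4 / 2187000)) + c ^ 4 * (y ^ 9 * ((4 * t ^ 3 - 135) / 8748000))"
    unfolding subleading_expansion_def
    by (simp add: algebra_simps power_divide add_divide_distrib diff_divide_distrib)
  then have *: "- (45 * c ^ 4) - c ^ 2 * t + c / 2 - t ^ 2 / 90 + t / 180 * y - (2 * t ^ 3 - 45) / 48600 * y ^ 2
     + t ^ 4 / 4374000 * y ^ 4 - (4 * t ^ 3 - 135) / 17496000 * y ^ 5 = - (c ^ 4 * subleading_expansion (t / 90) y) / 2"
    unfolding reduce by (simp add: algebra_simps add_divide_distrib diff_divide_distrib)
  show ?thesis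
    unfolding root450 x powrs \<rho>_def[symmetric] c_def[symmetric] minus_divide_left[symmetric] terms quotients
    using * by (simp only: y_def)
qed

section \<open>Positive solutions of the string equation\<close>

text \<open>\<open>A\<close> is the limit superior, obtained as the infimum of all eventual upper
  bounds and therefore a real number. Applied to the negated sequence, it serves as limit
  inferior.\<close>

lemma bounded_limsup:
  fixes X :: "nat \<Rightarrow> real"
  assumes "eventually (\<lambda>n. X n \<le> B) sequentially" and "eventually (\<lambda>n. B' \<le> X n) sequentially"
  obtains A where "\<And>e. e > 0 \<Longrightarrow> eventually (\<lambda>n. X n < A + e) sequentially"
    and "\<And>e. e > 0 \<Longrightarrow> frequently (\<lambda>n. X n > A - e) sequentially"
proof -
  define S where "S = {u. eventually (\<lambda>n. X n \<le> u) sequentially}"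
  have "B \<in> S" using assms(1) by (simp add: S_def)
  have "B' \<le> u" if "u \<in> S" for u
  proof -
    have "eventually (\<lambda>n. B' \<le> u) sequentially"
      using assms(2) that unfolding S_def mem_Collect_eq by eventually_elim linarith
    then show ?thesis by simp
  qed
  then have bdd: "bdd_below S" by (intro bdd_belowI)
  show ?thesis
  proof (rule that[of "Inf S"])
    fix e :: real assume "e > 0"
    then obtain u where "u \<in> S" "u < Inf S + e"
      using cInf_lessD[of S "Inf S + e"] \<open>B \<in> S\<close> by auto
    then show "eventually (\<lambda>n. X n < Inf S + e) sequentially"
      unfolding S_def mem_Collect_eq by (auto elim: eventually_mono)
    have "Inf S - e \<notin> S"
      using cInf_lower[OF _ bdd, of "Inf S - e"] \<open>e > 0\<close> by auto
    then show "frequently (\<lambda>n. X n > Inf S - e) sequentially"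
      by (simp add: S_def frequently_def not_less)
  qed
qed

text \<open>The hypothesis bounds \<open>u (n + 2)\<close> by all later values too, so induction on
  \<open>u\<close> is impossible. The suprema \<open>S n\<close> over tails satisfy S(n+2) \<le>
  \<theta> S(n) + K n^(-s), which goes forward in steps of 2.\<close>

lemma sup_recursion_decay:
  fixes u :: "nat \<Rightarrow> real"
  assumes nonneg: "\<And>n. u n \<ge> 0" and bound: "\<And>n. u n \<le> B"
    and \<theta>: "0 \<le> \<theta>" "\<theta> < 1" and s: "s \<ge> 0" and K: "K \<ge> 0"
    and step: "eventually (\<lambda>n. \<forall>M. (\<forall>k\<ge>n. u k \<le> M) \<longrightarrow> u (n + 2) \<le> \<theta> * M + K * real n powr -s) sequentially"
  shows "u \<in> O(\<lambda>n. real n powr -s)"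
proof -
  define S where "S n = (SUP k\<in>{n..}. u k)" for n
  have bdd: "bdd_above (u ` {n..})" for n
    using bound by (intro bdd_aboveI[of _ B]) auto
  have u_le_S: "u k \<le> S n" if "k \<ge> n" for k n
    unfolding S_def using that by (intro cSUP_upper bdd) auto
  \<comment> \<open>The midpoint of \<theta> and 1 leaves room for the ratio of n^(-s) to
    (n+2)^(-s), which exceeds 1 slightly.\<close>
  define \<theta>' where "\<theta>' = (1 + \<theta>) / 2"
  have "((\<lambda>n. \<theta> * (real n powr -s / (real (n + 2)) powr -s)) \<longlongrightarrow> \<theta> * 1) sequentially"
    by (intro tendsto_intros) real_asymp
  then have "eventually (\<lambda>n. \<theta> * (real n powr -s / (real (n + 2)) powr -s) < \<theta>') sequentially"
    by (rule order_tendstoD) (use \<theta> in \<open>simp add: \<theta>'_def\<close>)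
  moreover have "((\<lambda>n. real n powr -s / (real (n + 2)) powr -s) \<longlongrightarrow> 1) sequentially"
    by real_asymp
  then have "eventually (\<lambda>n. real n powr -s / (real (n + 2)) powr -s < 2) sequentially"
    by (rule order_tendstoD) simp
  ultimately have "eventually (\<lambda>n. n > 0 \<and> \<theta> * real n powr -s \<le> \<theta>' * real (n + 2) powr -s
     \<and> real n powr -s \<le> 2 * real (n + 2) powr -s) sequentially"
    using eventually_gt_at_top[of 0]
    by eventually_elim (auto simp: field_simps)
  with step have "eventually (\<lambda>n. n > 0 \<and> \<theta> * real n powr -s \<le> \<theta>' * real (n + 2) powr -s
     \<and> real n powr -s \<le> 2 * real (n + 2) powr -s
     \<and> (\<forall>M. (\<forall>k\<ge>n. u k \<le> M) \<longrightarrow> u (n + 2) \<le> \<theta> * M + K * real n powr -s)) sequentially"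
    by eventually_elim auto
  then obtain N where N: "\<And>n. n \<ge> N \<Longrightarrow> n > 0"
      "\<And>n. n \<ge> N \<Longrightarrow> \<theta> * real n powr -s \<le> \<theta>' * real (n + 2) powr -s"
      "\<And>n. n \<ge> N \<Longrightarrow> real n powr -s \<le> 2 * real (n + 2) powr -s"
      "\<And>n M. n \<ge> N \<Longrightarrow> (\<forall>k\<ge>n. u k \<le> M) \<Longrightarrow> u (n + 2) \<le> \<theta> * M + K * real n powr -s"
    unfolding eventually_sequentially by blast
  have S_step: "S (n + 2) \<le> \<theta> * S n + K * real n powr -s" if n: "n \<ge> N" for n
    unfolding S_def[of "n + 2"]
  proof (rule cSUP_least)
    fix k assume "k \<in> {n + 2..}"
    then obtain m where m: "k = m + 2" "m \<ge> n"
      by (intro that[of "k - 2"]) auto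
    have "u (m + 2) \<le> \<theta> * S n + K * real m powr -s"
      using N(4)[of m "S n"] u_le_S m n by auto
    also have "real m powr -s \<le> real n powr -s"
      using m s N(1)[OF n] by (intro powr_mono2') auto
    finally show "u k \<le> \<theta> * S n + K * real n powr -s"
      using m K by (auto intro: mult_left_mono)
  qed auto
  \<comment> \<open>The first entry gives \<theta>' C + 2 K \<le> C for the induction step; the
    others cover the two base cases that a recursion of step 2 demands.\<close>
  define C where "C = max (2 * K / (1 - \<theta>')) (max (S N / real N powr -s) (S (N + 1) / real (N + 1) powr -s))"
  have \<theta>': "\<theta>' < 1" using \<theta> by (simp add: \<theta>'_def)
  have CK: "\<theta>' * C + 2 * K \<le> C"
  proof -
    have "2 * K / (1 - \<theta>') \<le> C" by (simp add: C_def)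
    with \<theta>' show ?thesis by (simp add: field_simps)
  qed
  have "C \<ge> 0"
    using K \<theta>' by (auto simp: C_def intro!: max.coboundedI1)
  have S_bound: "S n \<le> C * real n powr -s" if "n \<ge> N" for n
    using that
  proof (induction n rule: less_induct)
    case (less n)
    consider "n = N" | "n = N + 1" | "n \<ge> N + 2"
      using less.prems by linarith
    then show ?case
    proof cases
      case 1
      have "S N / real N powr -s \<le> C" by (simp add: C_def)
      with 1 N(1)[of N] show ?thesis by (simp add: divide_le_eq)
    next
      case 2
      have "S (N + 1) / real (N + 1) powr -s \<le> C" unfolding C_def by linarith
      moreover have "real (N + 1) powr -s > 0" by simp
      ultimately show ?thesis unfolding 2 by (simp only: pos_divide_le_eq)
    next
      case 3
      define m where "m = n - 2"
      have m: "m \<ge> N" "n = m + 2" using 3 by (auto simp: m_def)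
      have "S n \<le> \<theta> * S m + K * real m powr -s"
        using S_step[OF m(1)] m(2) by simp
      also have "S m \<le> C * real m powr -s"
        using less.IH[of m] m by simp
      then have "\<theta> * S m \<le> C * (\<theta> * real m powr -s)"
        using mult_left_mono[OF _ \<theta>(1), of "S m" "C * real m powr -s"] by (simp add: mult_ac)
      also have "\<dots> \<le> C * (\<theta>' * real n powr -s)"
        using N(2)[OF m(1)] m(2) \<open>C \<ge> 0\<close> by (intro mult_left_mono) auto
      also have "K * real m powr -s \<le> K * (2 * real n powr -s)"
        using N(3)[OF m(1)] m(2) K by (intro mult_left_mono) auto
      also have "C * (\<theta>' * real n powr -s) + K * (2 * real n powr -s) = (\<theta>' * C + 2 * K) * real n powr -s"
        by (simp add: algebra_simps)
      also have "\<dots> \<le> C * real n powr -s"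
        using CK by (intro mult_right_mono) auto
      finally show ?thesis by simp
    qed
  qed
  show ?thesis
  proof (rule bigoI)
    show "eventually (\<lambda>n. norm (u n) \<le> C * norm (real n powr -s)) sequentially"
      using eventually_ge_at_top[of N]
    proof eventually_elim
      case (elim n)
      then show ?case using S_bound[of n] u_le_S[of n n] nonneg[of n] by simp
    qed
  qed
qed

text \<open>This locale and the next one assume conclusions: the sublocale proofs below establish
  them for every \<open>freud6_solution\<close>, first the leading order and then the refined
  approximation.\<close>

locale cbrt60_asymptotic =
  fixes b :: "nat \<Rightarrow> real"
  assumes tendsto_1: "(\<lambda>n. b n / cbrt60 (real n)) \<longlonglongrightarrow> 1"

locale b_approximated =
  fixes b :: "nat \<Rightarrow> real" and a :: real
  assumes approx: "(\<lambda>n. (b n - b_approx a (real n)) / cbrt60 (real n)) \<in> O(\<lambda>n. real n powr - (10 / 3))"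

locale freud6_solution =
  fixes b :: "nat \<Rightarrow> real" and t :: real
  assumes pos: "b n > 0"
    and eq: "eventually (\<lambda>n. freud6 (b n) (b (n + 1)) (b (n + 2)) (b (n + 3)) (b (n + 4))
      = real (n + 2) / 6 + t / 3 * b (n + 2)) sequentially"

text \<open>Freud's argument: with \<open>A\<close> and \<open>a\<close> the limits superior and inferior of the normalized sequence,
  monotonicity gives \<open>freud6 a a A a a \<le> 10 \<le> freud6 A A a A A\<close>, and the left-hand side
  minus the right-hand side is \<open>(A - a) (A\<^sup>2 + a\<^sup>2)\<close>.\<close>

sublocale freud6_solution \<subseteq> cbrt60_asymptotic b
proof
  define x where "x n = b n / cbrt60 (real n)" for n
  define X where "X j n = b (n + j) / cbrt60 (real (n + 2))" for j n
  have x_nonneg: "x n \<ge> 0" for n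
    using pos[of n] by (simp add: x_def cbrt60_def)
  have X_pos: "X j n > 0" for j n
    using pos[of "n + j"] cbrt60_pos[of "real (n + 2)"] by (simp add: X_def)
  have X2: "X 2 n = x (n + 2)" for n
    by (simp add: X_def x_def)
  have norm_eq: "eventually (\<lambda>n. freud6 (X 0 n) (X 1 n) (X 2 n) (X 3 n) (X 4 n)
      = 10 + t / 3 * X 2 n / cbrt60 (real (n + 2)) ^ 2) sequentially"
    using eq unfolding X_def by eventually_elim (rule freud6_normalized)
  \<comment> \<open>A value z > B would give z^3 > B z = 11 z + |t| z > 10 + |t| z, against the
    normalized equation.\<close>
  define B where "B = 11 + \<bar>t\<bar>"
  have "eventually (\<lambda>n. cbrt60 (real (n + 2)) \<ge> 1) sequentially"
    using cbrt60_at_top[of 2] unfolding filterlim_at_top by blast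
  with norm_eq have "eventually (\<lambda>n. x (n + 2) \<le> B) sequentially"
  proof eventually_elim
    case (elim n)
    let ?z = "X 2 n"
    have "?z ^ 3 \<le> 10 + t / 3 * ?z / cbrt60 (real (n + 2)) ^ 2"
      using freud6_ge_cube[of "X 0 n" "X 1 n" "X 2 n" "X 3 n" "X 4 n"] X_pos[THEN less_imp_le] elim(1) by simp
    also have "t / 3 * ?z / cbrt60 (real (n + 2)) ^ 2 \<le> \<bar>t\<bar> * ?z"
    proof -
      have "t / 3 * ?z / cbrt60 (real (n + 2)) ^ 2 \<le> \<bar>t\<bar> * ?z / cbrt60 (real (n + 2)) ^ 2"
        using X_pos[of 2 n] by (intro divide_right_mono mult_right_mono) auto
      also have "\<dots> \<le> \<bar>t\<bar> * ?z / 1"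
        using X_pos[of 2 n] elim(2) by (intro divide_left_mono) auto
      finally show ?thesis by simp
    qed
    finally have cube: "?z ^ 3 \<le> 10 + \<bar>t\<bar> * ?z" by simp
    have "?z \<le> B"
    proof (rule ccontr)
      assume "\<not> ?z \<le> B"
      then have z: "?z > B" "?z > 1" by (auto simp: B_def)
      then have "B * ?z < ?z * ?z" "1 * ?z \<le> ?z * ?z"
        by (auto intro!: mult_strict_right_mono mult_right_mono)
      then have "?z ^ 3 > B * ?z"
        using mult_strict_right_mono[of "?z" "?z * ?z" ?z] z
          mult_left_mono[of 1 "?z" "?z * ?z"] unfolding power3_eq_cube by linarith
      moreover have "B * ?z \<ge> 10 + \<bar>t\<bar> * ?z"
        using z by (simp add: B_def algebra_simps)
      ultimately show False using cube by linarith
    qed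
    then show ?case by (simp add: X2)
  qed
  then have x_le: "eventually (\<lambda>n. x n \<le> B) sequentially"
    by (rule eventually_sequentially_seg[THEN iffD1])
  \<comment> \<open>The scales at n+j and n+2 have ratio tending to 1 and \<open>x\<close> is
    bounded, so the eventual bounds on \<open>x\<close> carry over to every
    \<open>X j\<close>.\<close>
  have X_diff: "(\<lambda>n. X j n - x (n + j)) \<longlonglongrightarrow> 0" for j
  proof -
    have *: "X j n - x (n + j) = (cbrt60 (real (n + j)) / cbrt60 (real (n + 2)) - 1) * x (n + j)" if "n > 0" for n
      using that cbrt60_pos[of "real (n + j)"] cbrt60_pos[of "real (n + 2)"] by (simp add: X_def x_def field_simps)
    have "Bseq (\<lambda>n. x (n + j))"
    proof (rule BfunI)
      show "eventually (\<lambda>n. norm (x (n + j)) \<le> B) sequentially"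
        using eventually_sequentially_seg[of "\<lambda>n. x n \<le> B" j] x_le x_nonneg by simp
    qed
    moreover have "Zfun (\<lambda>n. cbrt60 (real (n + j)) / cbrt60 (real (n + 2)) - 1) sequentially"
      using cbrt60_ratio_tendsto[of j 2] by (simp only: tendsto_Zfun_iff)
    ultimately have "Zfun (\<lambda>n. (cbrt60 (real (n + j)) / cbrt60 (real (n + 2)) - 1) * x (n + j)) sequentially"
      by (intro bounded_bilinear.Zfun_prod_Bfun[OF bounded_bilinear_mult])
    then have "(\<lambda>n. (cbrt60 (real (n + j)) / cbrt60 (real (n + 2)) - 1) * x (n + j)) \<longlonglongrightarrow> 0"
      by (simp add: tendsto_Zfun_iff)
    then show ?thesis
      by (rule Lim_transform_eventually) (use eventually_gt_at_top[of 0] in eventually_elim, simp add: *)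
  qed
  obtain A where A_ev: "\<And>e. e > 0 \<Longrightarrow> eventually (\<lambda>n. x n < A + e) sequentially"
    and A_fr: "\<And>e. e > 0 \<Longrightarrow> frequently (\<lambda>n. x n > A - e) sequentially"
    using bounded_limsup[OF x_le always_eventually[OF allI[OF x_nonneg]]] by blast
  obtain A' where A'_ev: "\<And>e. e > 0 \<Longrightarrow> eventually (\<lambda>n. - x n < A' + e) sequentially"
    and A'_fr: "\<And>e. e > 0 \<Longrightarrow> frequently (\<lambda>n. - x n > A' - e) sequentially"
    using bounded_limsup[of "\<lambda>n. - x n" 0 "- B"] x_le x_nonneg by auto
  define a where "a = - A'"
  have a_ev: "eventually (\<lambda>n. x n > a - e) sequentially" and a_fr: "frequently (\<lambda>n. x n < a + e) sequentially"
    if "e > 0" for e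
    using A'_ev[OF that] A'_fr[OF that] by (auto simp: a_def elim: eventually_mono frequently_elim1)
  have X_less: "eventually (\<lambda>n. X j n < A + e) sequentially" and X_gt: "eventually (\<lambda>n. X j n > a - e) sequentially"
    if e: "e > 0" for j e
  proof -
    have "eventually (\<lambda>n. \<bar>X j n - x (n + j)\<bar> < e / 2) sequentially"
      using tendstoD[OF X_diff, of "e / 2" j] e by (simp add: dist_real_def)
    moreover have "eventually (\<lambda>n. x (n + j) < A + e / 2) sequentially" "eventually (\<lambda>n. x (n + j) > a - e / 2) sequentially"
      using A_ev[of "e / 2"] a_ev[of "e / 2"] e
        eventually_sequentially_seg[of "\<lambda>n. x n < A + e / 2" j]
        eventually_sequentially_seg[of "\<lambda>n. x n > a - e / 2" j] by auto
    ultimately have "eventually (\<lambda>n. X j n < A + e \<and> X j n > a - e) sequentially"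
      by eventually_elim linarith
    then show "eventually (\<lambda>n. X j n < A + e) sequentially" "eventually (\<lambda>n. X j n > a - e) sequentially"
      by (auto elim: eventually_mono)
  qed
  have shift_fr: "frequently (\<lambda>n. R (n + 2)) sequentially" if "frequently R sequentially" for R :: "nat \<Rightarrow> bool"
    using that eventually_sequentially_seg[of "\<lambda>n. \<not> R n" 2] by (simp add: frequently_def)
  have small: "eventually (\<lambda>n. \<bar>t / 3 * X 2 n / cbrt60 (real (n + 2)) ^ 2\<bar> < e) sequentially" if "e > 0" for e
  proof -
    have "eventually (\<lambda>n. \<bar>t\<bar> / 3 * B / cbrt60 (real (n + 2)) ^ 2 < e) sequentially"
    proof (rule order_tendstoD(2))
      show "(\<lambda>n. \<bar>t\<bar> / 3 * B / cbrt60 (real (n + 2)) ^ 2) \<longlonglongrightarrow> 0"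
        by (intro tendsto_divide_0[OF tendsto_const] filterlim_at_top_imp_at_infinity filterlim_pow_at_top cbrt60_at_top) simp
    qed fact
    moreover have "eventually (\<lambda>n. x (n + 2) \<le> B) sequentially"
      using x_le by (simp only: eventually_sequentially_seg[of "\<lambda>n. x n \<le> B" 2])
    ultimately show ?thesis
    proof eventually_elim
      case (elim n)
      have "\<bar>t / 3 * X 2 n / cbrt60 (real (n + 2)) ^ 2\<bar> = \<bar>t\<bar> / 3 * X 2 n / cbrt60 (real (n + 2)) ^ 2"
        using X_pos[of 2 n] by (simp add: abs_mult)
      also have "\<dots> \<le> \<bar>t\<bar> / 3 * B / cbrt60 (real (n + 2)) ^ 2"
        using elim(2) by (intro divide_right_mono mult_left_mono) (auto simp: X2)
      finally show ?case using elim(1) by linarith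
    qed
  qed
  have "a \<ge> 0"
  proof (rule ccontr)
    assume "\<not> a \<ge> 0"
    then have "frequently (\<lambda>n. x n < 0) sequentially"
      using a_fr[of "- a"] by simp
    then show False using x_nonneg by (simp add: frequently_def not_less)
  qed
  have "a \<le> A"
  proof (rule ccontr)
    assume "\<not> a \<le> A"
    then have "eventually (\<lambda>n. x n < A + (a - A) / 2) sequentially" "eventually (\<lambda>n. x n > a - (a - A) / 2) sequentially"
      by (intro A_ev a_ev; simp)+
    then have "eventually (\<lambda>n. False) sequentially"
      by eventually_elim (simp add: field_simps)
    then show False by simp
  qed
  define f where "f z w = z * (5 * w ^ 2 + 4 * z * w + z ^ 2)" for z w :: real
  have f: "freud6 w w z w w = f z w" for z w
    by (simp add: freud6_def f_def algebra_simps power2_eq_square)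
  have lower: "10 \<le> f a A"
  proof -
    have "10 - e \<le> f (a + e) (A + e)" if e: "e > 0" for e :: real
    proof -
      have "frequently (\<lambda>n. X 2 n < a + e) sequentially"
        using shift_fr[OF a_fr[OF e]] by (simp add: X2)
      moreover have "eventually (\<lambda>n. X 0 n < A + e \<and> X 1 n < A + e \<and> X 3 n < A + e \<and> X 4 n < A + e
          \<and> \<bar>t / 3 * X 2 n / cbrt60 (real (n + 2)) ^ 2\<bar> < e \<and> freud6 (X 0 n) (X 1 n) (X 2 n) (X 3 n) (X 4 n)
          = 10 + t / 3 * X 2 n / cbrt60 (real (n + 2)) ^ 2) sequentially"
        using e by (intro eventually_conj X_less small norm_eq)
      ultimately have "frequently (\<lambda>n. 10 - e \<le> f (a + e) (A + e)) sequentially"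
      proof (rule frequently_elim1[OF frequently_eventually_frequently])
        fix n
        assume n: "X 2 n < a + e \<and> X 0 n < A + e \<and> X 1 n < A + e \<and> X 3 n < A + e \<and> X 4 n < A + e
          \<and> \<bar>t / 3 * X 2 n / cbrt60 (real (n + 2)) ^ 2\<bar> < e \<and> freud6 (X 0 n) (X 1 n) (X 2 n) (X 3 n) (X 4 n)
          = 10 + t / 3 * X 2 n / cbrt60 (real (n + 2)) ^ 2"
        then have "10 - e \<le> freud6 (X 0 n) (X 1 n) (X 2 n) (X 3 n) (X 4 n)" by linarith
        also have "\<dots> \<le> freud6 (A + e) (A + e) (a + e) (A + e) (A + e)"
          using n X_pos by (intro freud6_mono) (auto intro: less_imp_le)
        finally show "10 - e \<le> f (a + e) (A + e)" by (simp add: f)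
      qed
      \<comment> \<open>The inequality no longer mentions n, so holding frequently means
        holding.\<close>
      then show ?thesis by (simp add: frequently_const_iff)
    qed
    then have "eventually (\<lambda>e. 10 - e \<le> f (a + e) (A + e)) (at_right 0)"
      by (auto simp: eventually_at_right_field intro: exI[of _ 1])
    moreover have "((\<lambda>e. f (a + e) (A + e)) \<longlongrightarrow> f (a + 0) (A + 0)) (at_right 0)"
      unfolding f_def by (intro tendsto_intros)
    moreover have "((\<lambda>e::real. 10 - e) \<longlongrightarrow> 10 - 0) (at_right 0)"
      by (intro tendsto_intros)
    ultimately have "10 - 0 \<le> f (a + 0) (A + 0)"
      by (intro tendsto_le[OF trivial_limit_at_right_real])
    then show ?thesis by simp
  qed
  have "a > 0"
    using lower \<open>a \<ge> 0\<close> by (cases "a = 0") (auto simp: f_def)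
  have upper: "f A a \<le> 10"
  proof -
    \<comment> \<open>The restriction e < a, available because a > 0, keeps the smaller arguments
      nonnegative as \<open>freud6_mono\<close> requires.\<close>
    have "f (A - e) (a - e) \<le> 10 + e" if e: "e > 0" "e < a" for e
    proof -
      have "frequently (\<lambda>n. X 2 n > A - e) sequentially"
        using shift_fr[OF A_fr[OF e(1)]] by (simp add: X2)
      moreover have "eventually (\<lambda>n. X 0 n > a - e \<and> X 1 n > a - e \<and> X 3 n > a - e \<and> X 4 n > a - e
          \<and> \<bar>t / 3 * X 2 n / cbrt60 (real (n + 2)) ^ 2\<bar> < e \<and> freud6 (X 0 n) (X 1 n) (X 2 n) (X 3 n) (X 4 n)
          = 10 + t / 3 * X 2 n / cbrt60 (real (n + 2)) ^ 2) sequentially"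
        using e by (intro eventually_conj X_gt small norm_eq)
      ultimately have "frequently (\<lambda>n. f (A - e) (a - e) \<le> 10 + e) sequentially"
      proof (rule frequently_elim1[OF frequently_eventually_frequently])
        fix n
        assume n: "X 2 n > A - e \<and> X 0 n > a - e \<and> X 1 n > a - e \<and> X 3 n > a - e \<and> X 4 n > a - e
          \<and> \<bar>t / 3 * X 2 n / cbrt60 (real (n + 2)) ^ 2\<bar> < e \<and> freud6 (X 0 n) (X 1 n) (X 2 n) (X 3 n) (X 4 n)
          = 10 + t / 3 * X 2 n / cbrt60 (real (n + 2)) ^ 2"
        have "freud6 (a - e) (a - e) (A - e) (a - e) (a - e) \<le> freud6 (X 0 n) (X 1 n) (X 2 n) (X 3 n) (X 4 n)"
          using n e \<open>a \<le> A\<close> by (intro freud6_mono) auto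
        also have "\<dots> \<le> 10 + e" using n by linarith
        finally show "f (A - e) (a - e) \<le> 10 + e" by (simp add: f)
      qed
      then show ?thesis by (simp add: frequently_const_iff)
    qed
    then have "eventually (\<lambda>e. f (A - e) (a - e) \<le> 10 + e) (at_right 0)"
      using \<open>a > 0\<close> by (auto simp: eventually_at_right_field)
    moreover have "((\<lambda>e. f (A - e) (a - e)) \<longlongrightarrow> f (A - 0) (a - 0)) (at_right 0)"
      unfolding f_def by (intro tendsto_intros)
    moreover have "((\<lambda>e::real. 10 + e) \<longlongrightarrow> 10 + 0) (at_right 0)"
      by (intro tendsto_intros)
    ultimately have "f (A - 0) (a - 0) \<le> 10 + 0"
      by (intro tendsto_le[OF trivial_limit_at_right_real])
    then show ?thesis by simp
  qed
  have "(A - a) * (A ^ 2 + a ^ 2) = f A a - f a A"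
    by (simp add: f_def algebra_simps power2_eq_square)
  then have "(A - a) * (A ^ 2 + a ^ 2) \<le> 0"
    using lower upper by simp
  moreover have "A ^ 2 + a ^ 2 > 0"
    using \<open>a > 0\<close> by (simp add: add_nonneg_pos)
  ultimately have "A = a"
    using \<open>a \<le> A\<close> by (simp add: mult_le_0_iff)
  then have "10 * a ^ 3 = 10 * 1"
    using lower upper by (simp add: f_def power2_eq_square power3_eq_cube)
  then have "a = 1"
    using \<open>a > 0\<close> power_eq_iff_eq_base[of 3 a 1] by simp
  have "x \<longlonglongrightarrow> 1"
  proof (rule tendstoI)
    fix e :: real assume "e > 0"
    then have "eventually (\<lambda>n. x n < 1 + e) sequentially" "eventually (\<lambda>n. x n > 1 - e) sequentially"
      using A_ev[of e] a_ev[of e] \<open>A = a\<close> \<open>a = 1\<close> by auto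
    then show "eventually (\<lambda>n. dist (x n) 1 < e) sequentially"
      by eventually_elim (simp add: dist_real_def abs_less_iff)
  qed
  then show "(\<lambda>n. b n / cbrt60 (real n)) \<longlonglongrightarrow> 1" by (simp add: x_def[abs_def])
qed

text \<open>In the difference of the two normalized equations the \<open>t\<close>-term has a
  vanishing factor and the residual is O(y^10). Diagonal dominance thus bounds the relative error
  \<open>u (n + 2)\<close> by a fraction of any tail bound \<open>M\<close>, as
  \<open>sup_recursion_decay\<close> expects.\<close>

sublocale freud6_solution \<subseteq> b_approximated b "t / 90"
proof
  define a where "a = t / 90"
  define \<nu> where "\<nu> n = cbrt60 (real (n + 2))" for n
  define X where "X j n = b (n + j) / \<nu> n" for j n
  define Y where "Y j n = b_approx a (real (n + j)) / \<nu> n" for j n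
  define u where "u n = \<bar>b n - b_approx a (real n)\<bar> / cbrt60 (real n)" for n
  define r where "r n = freud6 (Y 0 n) (Y 1 n) (Y 2 n) (Y 3 n) (Y 4 n) - (10 + 30 * a * (1 / \<nu> n) ^ 2 * Y 2 n)" for n
  have \<nu>_pos: "\<nu> n > 0" for n by (simp add: \<nu>_def cbrt60_pos)
  have u_nonneg: "u n \<ge> 0" for n by (simp add: u_def cbrt60_def)
  have "(\<lambda>n. \<bar>b n / cbrt60 (real n) - b_approx a (real n) / cbrt60 (real n)\<bar>) \<longlonglongrightarrow> \<bar>1 - 1\<bar>"
    by (intro tendsto_intros tendsto_1 b_approx_tendsto)
  also have "(\<lambda>n. \<bar>b n / cbrt60 (real n) - b_approx a (real n) / cbrt60 (real n)\<bar>) = u"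
    by (simp add: u_def fun_eq_iff abs_divide cbrt60_def flip: diff_divide_distrib)
  finally have "u \<longlonglongrightarrow> 0" by simp
  then have "Bseq u" by (simp add: convergent_def convergent_imp_Bseq exI)
  then obtain B where B: "u n \<le> B" for n
    by (auto simp: Bseq_def abs_le_iff)
  have near: "eventually (\<lambda>n. \<bar>X j n - 1\<bar> \<le> 1/100 \<and> \<bar>Y j n - 1\<bar> \<le> 1/100) sequentially" for j
  proof -
    have lims: "X j \<longlonglongrightarrow> 1" "Y j \<longlonglongrightarrow> 1"
      unfolding X_def Y_def \<nu>_def by (intro normalized_shift_tendsto tendsto_1 b_approx_tendsto)+
    have "eventually (\<lambda>n. dist (X j n) 1 < 1/100) sequentially"
      by (rule tendstoD[OF lims(1)]) simp
    moreover have "eventually (\<lambda>n. dist (Y j n) 1 < 1/100) sequentially"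
      by (rule tendstoD[OF lims(2)]) simp
    ultimately show ?thesis by eventually_elim (simp add: dist_real_def)
  qed
  have ratio: "eventually (\<lambda>n. cbrt60 (real (n + j)) / \<nu> n \<le> 101/100) sequentially" for j
    using order_tendstoD(2)[OF cbrt60_ratio_tendsto[of j 2], of "101/100"]
    unfolding \<nu>_def by (auto elim: eventually_mono)
  have "r \<in> O(\<lambda>n. (1 / \<nu> n) ^ 10)"
    unfolding r_def[abs_def] Y_def \<nu>_def by (rule b_approx_residual)
  also have "(\<lambda>n. (1 / \<nu> n) ^ 10) \<in> O(\<lambda>n. real n powr - (10 / 3))"
    unfolding \<nu>_def cbrt60_def by real_asymp
  finally obtain C where C: "C > 0" "eventually (\<lambda>n. \<bar>r n\<bar> \<le> C * real n powr - (10 / 3)) sequentially"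
    by (auto elim!: landau_o.bigE)
  have small: "eventually (\<lambda>n. \<bar>30 * a * (1 / \<nu> n) ^ 2\<bar> < 1/10) sequentially"
  proof (rule order_tendstoD(2))
    have "(\<lambda>n. 1 / \<nu> n) \<longlonglongrightarrow> 0"
      unfolding \<nu>_def cbrt60_def by real_asymp
    then have "(\<lambda>n. \<bar>30 * a * (1 / \<nu> n) ^ 2\<bar>) \<longlonglongrightarrow> \<bar>30 * a * 0 ^ 2\<bar>"
      by (intro tendsto_intros)
    then show "(\<lambda>n. \<bar>30 * a * (1 / \<nu> n) ^ 2\<bar>) \<longlonglongrightarrow> 0" by simp
  qed simp
  have step: "eventually (\<lambda>n. \<forall>M. (\<forall>k\<ge>n. u k \<le> M) \<longrightarrow> u (n + 2) \<le> 19/20 * M + C * real n powr - (10 / 3)) sequentially"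
    using eq C(2) small eventually_gt_at_top[of 0] near[of 0] near[of 1] near[of 2] near[of 3] near[of 4]
      ratio[of 0] ratio[of 1] ratio[of 3] ratio[of 4]
  proof eventually_elim
    case (elim n)
    show ?case
    proof (intro allI impI)
      fix M assume M: "\<forall>k\<ge>n. u k \<le> M"
      then have "M \<ge> 0" using u_nonneg[of n] by force
      have XY: "\<bar>X j n - Y j n\<bar> = u (n + j) * (cbrt60 (real (n + j)) / \<nu> n)" for j
      proof -
        have "\<bar>X j n - Y j n\<bar> = \<bar>b (n + j) - b_approx a (real (n + j))\<bar> / \<nu> n"
          using \<nu>_pos[of n] by (simp add: X_def Y_def flip: diff_divide_distrib)
        also have "\<dots> = u (n + j) * (cbrt60 (real (n + j)) / \<nu> n)"
          unfolding u_def \<nu>_def using elim by (intro cbrt60_normalize_shift)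
        finally show ?thesis .
      qed
      have XY_le: "\<bar>X j n - Y j n\<bar> \<le> M * (101/100)" if "cbrt60 (real (n + j)) / \<nu> n \<le> 101/100" for j
        unfolding XY using M that \<open>M \<ge> 0\<close> \<nu>_pos[of n] u_nonneg
        by (intro mult_mono) (auto simp: cbrt60_def)
      have XY2: "\<bar>X 2 n - Y 2 n\<bar> = u (n + 2)"
        using XY[of 2] \<nu>_pos[of n] by (simp add: \<nu>_def)
      have eqX: "freud6 (X 0 n) (X 1 n) (X 2 n) (X 3 n) (X 4 n) = 10 + 30 * a * (1 / \<nu> n) ^ 2 * X 2 n"
        using freud6_normalized[of b n t] elim(1)
        by (simp add: X_def \<nu>_def a_def power_one_over)
      have "freud6 (X 0 n) (X 1 n) (X 2 n) (X 3 n) (X 4 n) - freud6 (Y 0 n) (Y 1 n) (Y 2 n) (Y 3 n) (Y 4 n)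
        = 30 * a * (1 / \<nu> n) ^ 2 * (X 2 n - Y 2 n) - r n"
        unfolding eqX r_def by (simp add: algebra_simps)
      also have "\<bar>\<dots>\<bar> \<le> \<bar>30 * a * (1 / \<nu> n) ^ 2\<bar> * \<bar>X 2 n - Y 2 n\<bar> + \<bar>r n\<bar>"
        using abs_triangle_ineq4[of "30 * a * (1 / \<nu> n) ^ 2 * (X 2 n - Y 2 n)" "r n"] by (simp only: abs_mult)
      also have "\<dots> \<le> 1/10 * u (n + 2) + C * real n powr - (10 / 3)"
        unfolding XY2 using elim(2,3) u_nonneg[of "n + 2"] by (intro add_mono mult_right_mono) auto
      finally have "\<bar>freud6 (X 0 n) (X 1 n) (X 2 n) (X 3 n) (X 4 n) - freud6 (Y 0 n) (Y 1 n) (Y 2 n) (Y 3 n) (Y 4 n)\<bar>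
        \<le> 1/10 * u (n + 2) + C * real n powr - (10 / 3)" .
      moreover have "78/5 * \<bar>X 2 n - Y 2 n\<bar> \<le> \<bar>freud6 (X 0 n) (X 1 n) (X 2 n) (X 3 n) (X 4 n)
          - freud6 (Y 0 n) (Y 1 n) (Y 2 n) (Y 3 n) (Y 4 n)\<bar> + 143/10 * (M * (101/100))"
        by (rule freud6_diagonally_dominant) (simp_all only: elim(5-13) XY_le)
      \<comment> \<open>Here 31/2 = 78/5 - 1/10 absorbs the \<open>t\<close>-term, and 14443/1000 is
        143/10 times the bound 101/100 on the ratio of scales. The quotient is about 0.932, below
        19/20.\<close>
      ultimately have "31/2 * u (n + 2) \<le> C * real n powr - (10 / 3) + 14443/1000 * M"
        unfolding XY2 by linarith
      moreover have "0 \<le> C * real n powr - (10 / 3)" using C(1) by simp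
      ultimately show "u (n + 2) \<le> 19/20 * M + C * real n powr - (10 / 3)"
        using \<open>M \<ge> 0\<close> by linarith
    qed
  qed
  have "u \<in> O(\<lambda>n. real n powr - (10 / 3))"
    using u_nonneg B _ _ _ _ step by (rule sup_recursion_decay) (use C in auto)
  then have "(\<lambda>n. \<bar>(b n - b_approx a (real n)) / cbrt60 (real n)\<bar>) \<in> O(\<lambda>n. real n powr - (10 / 3))"
    by (simp add: u_def[abs_def] abs_divide cbrt60_def)
  then show "(\<lambda>n. (b n - b_approx (t / 90) (real n)) / cbrt60 (real n)) \<in> O(\<lambda>n. real n powr - (10 / 3))"
    unfolding a_def by (simp only: landau_o.big.abs_in_iff)
qed

text \<open>The formula for p(n) is c^4 times a polynomial in y and the normalized entries. Their
  error n^(-10/3), which is the order y^10, survives as c^4 y^10 = c^(-6), of order n^(-2).\<close>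

lemma (in freud6_solution) subleading_asymptotics:
  "(\<lambda>n. - ((real (n + 2) - 1) * b (n + 2) + 6 * b (n + 3) * b (n + 2) * b (n + 1)
      * (b n + b (n + 1) + b (n + 2) + b (n + 3) + b (n + 4))) / 2
     - - (cbrt60 (real (n + 2)) ^ 4 * subleading_expansion (t / 90) (1 / cbrt60 (real (n + 2)))) / 2)
     \<in> O(\<lambda>n. real (n + 2) powr -2)"
proof -
  define a where "a = t / 90"
  define \<nu> where "\<nu> n = cbrt60 (real (n + 2))" for n
  define y where "y n = 1 / \<nu> n" for n
  define e where "e n = y n ^ 10" for n
  define X where "X j n = b (n + j) / \<nu> n" for j n
  define Y where "Y j n = b_approx a (real (n + j)) / \<nu> n" for j n
  define U where "U j n = taylor a j (y n)" for j n
  have XY: "bigo_close sequentially e (X j) (Y j)" for j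
    unfolding bigo_close_def
  proof (intro conjI)
    have "(\<lambda>n. (b (n + j) - b_approx a (real (n + j))) / cbrt60 (real (n + j))) \<in> O(\<lambda>n. real (n + j) powr - (10 / 3))"
      using landau_o.big.compose[OF approx filterlim_add_const_nat_at_top[of j]] unfolding a_def .
    also have "(\<lambda>n. real (n + j) powr - (10 / 3)) \<in> O(e)"
      unfolding e_def y_def \<nu>_def cbrt60_def by real_asymp
    finally have "(\<lambda>n. (b (n + j) - b_approx a (real (n + j))) / cbrt60 (real (n + j)) * (cbrt60 (real (n + j)) / cbrt60 (real (n + 2))))
       \<in> O(\<lambda>n. e n * 1)"
      by (rule landau_o.big.mult[OF _ bigo_1_if_tendsto[OF cbrt60_ratio_tendsto]])
    moreover have "eventually (\<lambda>n. X j n - Y j n = (b (n + j) - b_approx a (real (n + j))) / cbrt60 (real (n + j)) * (cbrt60 (real (n + j)) / cbrt60 (real (n + 2)))) sequentially"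
      using eventually_gt_at_top[of 0]
    proof eventually_elim
      case (elim n)
      show ?case
        unfolding X_def Y_def \<nu>_def diff_divide_distrib[symmetric] by (rule cbrt60_normalize_shift[OF elim])
    qed
    ultimately show "(\<lambda>n. X j n - Y j n) \<in> O(e)"
      by (simp add: landau_o.big.in_cong)
    show "X j \<in> O(\<lambda>_. 1)" "Y j \<in> O(\<lambda>_. 1)"
      unfolding X_def Y_def \<nu>_def
      by (rule bigo_1_if_tendsto[OF normalized_shift_tendsto[OF tendsto_1]]
          bigo_1_if_tendsto[OF normalized_shift_tendsto[OF b_approx_tendsto]])+
  qed
  have XU: "bigo_close sequentially e (X j) (U (real j - 2))" for j
    using XY b_approx_close_taylor[of a j] unfolding Y_def U_def e_def y_def \<nu>_def by (rule bigo_close_trans)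
  have XU': "bigo_close sequentially e (X 0) (U (-2))" "bigo_close sequentially e (X 1) (U (-1))"
      "bigo_close sequentially e (X 2) (U 0)" "bigo_close sequentially e (X 3) (U 1)" "bigo_close sequentially e (X 4) (U 2)"
    using XU[of 0] XU[of 1] XU[of 2] XU[of 3] XU[of 4] by simp_all
  have "(\<lambda>n. 60 - y n ^ 3) \<longlonglongrightarrow> 60"
    unfolding y_def \<nu>_def cbrt60_def by real_asymp
  then have y: "bigo_close sequentially e (\<lambda>n. 60 - y n ^ 3) (\<lambda>n. 60 - y n ^ 3)"
    by (intro bigo_close_refl bigo_1_if_tendsto)
  define G where "G n = (60 - y n ^ 3) * X 2 n + 6 * X 3 n * X 2 n * X 1 n * (X 0 n + X 1 n + X 2 n + X 3 n + X 4 n)" for n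
  define H where "H n = (60 - y n ^ 3) * U 0 n + 6 * U 1 n * U 0 n * U (-1) n * (U (-2) n + U (-1) n + U 0 n + U 1 n + U 2 n)" for n
  have "bigo_close sequentially e G H"
    unfolding G_def H_def by (intro bigo_close_add bigo_close_mult bigo_close_const y XU')
  then have "(\<lambda>n. G n - H n) \<in> O(e)" by (simp add: bigo_close_def)
  moreover have "(\<lambda>n. H n - subleading_expansion a (y n)) \<in> O(e)"
    unfolding H_def U_def y_def e_def \<nu>_def using landau_o.big.compose[OF subleading_taylor inverse_cbrt60_seq] .
  ultimately have "(\<lambda>n. (G n - H n) + (H n - subleading_expansion a (y n))) \<in> O(e)"
    by (rule sum_in_bigo(1))
  then have "(\<lambda>n. G n - subleading_expansion a (y n)) \<in> O(e)" by simp
  then have "(\<lambda>n. - (\<nu> n ^ 4) / 2 * (G n - subleading_expansion a (y n))) \<in> O(\<lambda>n. - (\<nu> n ^ 4) / 2 * e n)"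
    by (rule landau_o.big.mult_left)
  also have "(\<lambda>n. - (\<nu> n ^ 4) / 2 * e n) \<in> O(\<lambda>n. real (n + 2) powr -2)"
    unfolding e_def y_def \<nu>_def cbrt60_def by real_asymp
  also have "(\<lambda>n. - (\<nu> n ^ 4) / 2 * (G n - subleading_expansion a (y n)))
    = (\<lambda>n. - ((real (n + 2) - 1) * b (n + 2) + 6 * b (n + 3) * b (n + 2) * b (n + 1)
      * (b n + b (n + 1) + b (n + 2) + b (n + 3) + b (n + 4))) / 2
     - - (\<nu> n ^ 4 * subleading_expansion a (y n)) / 2)"
  proof
    fix n
    define N where "N = real (n + 2)"
    have \<nu>: "\<nu> n > 0" "N = 60 * \<nu> n ^ 3"
      using cbrt60_pos[of N] cbrt60_cube[of N] by (simp_all add: \<nu>_def N_def)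
    have bX: "b (n + j) = \<nu> n * X j n" for j
      using \<nu> by (simp add: X_def)
    have "(N - 1) * \<nu> n = \<nu> n ^ 4 * (60 - y n ^ 3)"
      unfolding \<nu>(2) y_def using \<nu>(1) by (simp add: field_simps eval_nat_numeral)
    then have "(N - 1) * (\<nu> n * X 2 n) = \<nu> n ^ 4 * ((60 - y n ^ 3) * X 2 n)"
      by (metis mult.assoc)
    then have "(N - 1) * b (n + 2) + 6 * b (n + 3) * b (n + 2) * b (n + 1)
      * (b (n + 0) + b (n + 1) + b (n + 2) + b (n + 3) + b (n + 4)) = \<nu> n ^ 4 * G n"
      unfolding bX G_def by (simp add: algebra_simps eval_nat_numeral)
    then have *: "(N - 1) * b (n + 2) + 6 * b (n + 3) * b (n + 2) * b (n + 1)
      * (b n + b (n + 1) + b (n + 2) + b (n + 3) + b (n + 4)) = \<nu> n ^ 4 * G n"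
      by (simp only: add_0_right)
    show "- (\<nu> n ^ 4) / 2 * (G n - subleading_expansion a (y n))
      = - ((real (n + 2) - 1) * b (n + 2) + 6 * b (n + 3) * b (n + 2) * b (n + 1)
      * (b n + b (n + 1) + b (n + 2) + b (n + 3) + b (n + 4))) / 2
     - - (\<nu> n ^ 4 * subleading_expansion a (y n)) / 2"
      unfolding N_def[symmetric] * by (simp add: field_simps)
  qed
  finally show ?thesis unfolding a_def y_def \<nu>_def .
qed

section \<open>Application to the orthogonal polynomials\<close>

sublocale sextic_orthogonal_polys \<subseteq> freud6_solution \<beta> t
proof
  show "\<beta> n > 0" for n by (rule \<beta>_pos)
  show "eventually (\<lambda>n. freud6 (\<beta> n) (\<beta> (n + 1)) (\<beta> (n + 2)) (\<beta> (n + 3)) (\<beta> (n + 4))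
      = real (n + 2) / 6 + t / 3 * \<beta> (n + 2)) sequentially"
    using eventually_ge_at_top[of 3]
  proof eventually_elim
    case (elim n)
    then show ?case
      using string_equation[of "n + 2"] by (simp add: freud6_def field_simps eval_nat_numeral)
  qed
qed

context sextic_orthogonal_polys
begin

lemma subleading_coeff_expansion:
  "(\<lambda>n. subleading_coeff P n
      - - (cbrt60 (real n) ^ 4 * subleading_expansion (t / 90) (1 / cbrt60 (real n))) / 2) \<in> O(\<lambda>n. real n powr -2)"
proof -
  define E where "E n = - (cbrt60 (real n) ^ 4 * subleading_expansion (t / 90) (1 / cbrt60 (real n))) / 2" for n
  have "(\<lambda>n. subleading_coeff P (n + 2) - E (n + 2)) \<in> O(\<lambda>n. real (n + 2) powr -2)"
  proof (rule landau_o.big.in_cong[THEN iffD2, OF _ subleading_asymptotics])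
    show "eventually (\<lambda>n. subleading_coeff P (n + 2) - E (n + 2)
      = - ((real (n + 2) - 1) * \<beta> (n + 2) + 6 * \<beta> (n + 3) * \<beta> (n + 2) * \<beta> (n + 1)
      * (\<beta> n + \<beta> (n + 1) + \<beta> (n + 2) + \<beta> (n + 3) + \<beta> (n + 4))) / 2
     - - (cbrt60 (real (n + 2)) ^ 4 * subleading_expansion (t / 90) (1 / cbrt60 (real (n + 2)))) / 2) sequentially"
      using eventually_ge_at_top[of 3]
    proof eventually_elim
      case (elim n)
      then show ?case
        using subleading_coeff_eq[of "n + 2"] by (simp add: E_def eval_nat_numeral)
    qed
  qed
  then obtain c where "eventually (\<lambda>n. norm (subleading_coeff P (n + 2) - E (n + 2))
      \<le> c * norm (real (n + 2) powr -2)) sequentially"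
    by (auto elim!: landau_o.bigE)
  then have "eventually (\<lambda>n. norm (subleading_coeff P n - E n) \<le> c * norm (real n powr -2)) sequentially"
    by (rule eventually_sequentially_seg[THEN iffD1])
  then show ?thesis
    unfolding E_def by (rule bigoI)
qed

end

theorem theorem3p2:
  fixes t :: real and P :: "nat \<Rightarrow> real poly"
  assumes "monic_orthogonal_polys (sextic_weight t) P"
  shows "(\<lambda>n. subleading_coeff P n -
           (- (3 * real n powr (4/3)) / (4 * root 3 60)
            - real n powr (2/3) * t / (2 * root 3 450)
            + real n powr (1/3) / (2 * root 3 60)
            - t ^ 2 / 90
            + t / (6 * root 3 450 * real n powr (1/3))
            - (2 * t ^ 3 - 45) / (810 * root 3 60 * real n powr (2/3))
            + t ^ 4 / (2430 * root 3 450 * real n powr (4/3))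
            - (4 * t ^ 3 - 135) / (4860 * root 3 60 * real n powr (5/3))))
         \<in> O(\<lambda>n. real n powr (-2))"
proof -
  obtain h where "\<And>j. h j > 0" and "\<And>j k. has_bochner_integral lborel
      (\<lambda>x. poly (P j) x * poly (P k) x * sextic_weight t x) (if j = k then h j else 0)"
    and "\<And>n. degree (P n) = n" and "\<And>n. lead_coeff (P n) = 1"
    using assms unfolding monic_orthogonal_polys_def by blast
  then have "sextic_orthogonal_polys t P h"
    by (intro sextic_orthogonal_polys.intro) auto
  then have "(\<lambda>n. subleading_coeff P n
      - - (cbrt60 (real n) ^ 4 * subleading_expansion (t / 90) (1 / cbrt60 (real n))) / 2) \<in> O(\<lambda>n. real n powr -2)"
    by (rule sextic_orthogonal_polys.subleading_coeff_expansion)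
  moreover have "eventually (\<lambda>n. subleading_coeff P n -
           (- (3 * real n powr (4/3)) / (4 * root 3 60)
            - real n powr (2/3) * t / (2 * root 3 450)
            + real n powr (1/3) / (2 * root 3 60)
            - t ^ 2 / 90
            + t / (6 * root 3 450 * real n powr (1/3))
            - (2 * t ^ 3 - 45) / (810 * root 3 60 * real n powr (2/3))
            + t ^ 4 / (2430 * root 3 450 * real n powr (4/3))
            - (4 * t ^ 3 - 135) / (4860 * root 3 60 * real n powr (5/3)))
      = subleading_coeff P n - - (cbrt60 (real n) ^ 4 * subleading_expansion (t / 90) (1 / cbrt60 (real n))) / 2) sequentially"
    using eventually_gt_at_top[of 0]
    by eventually_elim (simp only: subleading_expansion_eq of_nat_0_less_iff)
  ultimately show ?thesis
    by (simp only: landau_o.big.in_cong)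
qed

end
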